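(* There is an algorithm that, given an interval graph $G$ of order $n$, enumerates all minimal Roman dominating functions of $G$ in time $\mathcal{O}^*(\sqrt{3}^{\,n})$, with polynomial delay and using polynomial space.
   Context: All graphs are finite, undirected and simple. An interval graph is the intersection graph of a finite family of closed intervals on the real line (vertices correspond to intervals, adjacent iff the intervals intersect). For a graph $G=(V,E)$, a function $f\colon V\to\{0,1,2\}$ is a Roman dominating function (rdf) if every vertex $v$ with $f(v)=0$ has a neighbor $u$ with $f(u)=2$. Functions $V\to\{0,1,2\}$ are ordered pointwise: $f\le g$ iff $f(v)\le g(v)$ for all $v$. An rdf $f$ is minimal if there is no rdf $g\neq f$ with $g\le f$. Polynomial delay means the time before the first output, between consecutive outputs, and after the last output is bounded by a polynomial in $n$. The notation $\mathcal{O}^*(\cdot)$ suppresses factors polynomial in $n$. *)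

theory Defs
  imports
    Complex_Main
    "HOL-Library.FuncSet"
    "HOL-Library.Log_Nat"
    "HOL-Computational_Algebra.Polynomial"
    "Graph_Theory.Pair_Digraph"
begin

section \<open>Interval graphs and Roman domination\<close>

text \<open>
  Finite simple undirected graphs are the symmetric loop-free finite digraphs \<open>pair_graph\<close>.
  Nonempty closed real intervals are given by their end points.
\<close>

definition interval_graph :: "'a pair_pre_digraph \<Rightarrow> bool" where
  "interval_graph G \<longleftrightarrow> (\<exists>l r :: 'a \<Rightarrow> real.
     (\<forall>v\<in>pverts G. l v \<le> r v) \<and>
     (\<forall>u\<in>pverts G. \<forall>v\<in>pverts G. u \<noteq> v \<longrightarrow>
        ((u, v) \<in> parcs G \<longleftrightarrow> {l u..r u} \<inter> {l v..r v} \<noteq> {})))"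

text \<open>
  Functions on the vertex set are extensional, so that equality of Isabelle functions is equality
  of functions on the vertex set.
\<close>

definition roman_dominating :: "'a pair_pre_digraph \<Rightarrow> ('a \<Rightarrow> nat) \<Rightarrow> bool" where
  "roman_dominating G f \<longleftrightarrow> f \<in> pverts G \<rightarrow>\<^sub>E {0, 1, 2} \<and>
     (\<forall>v\<in>pverts G. f v = 0 \<longrightarrow> (\<exists>u\<in>pverts G. (v, u) \<in> parcs G \<and> f u = 2))"

definition minimal_roman_dominating :: "'a pair_pre_digraph \<Rightarrow> ('a \<Rightarrow> nat) \<Rightarrow> bool" where
  "minimal_roman_dominating G f \<longleftrightarrow> roman_dominating G f \<and>
     \<not> (\<exists>g. roman_dominating G g \<and> g \<noteq> f \<and> (\<forall>v\<in>pverts G. g v \<le> f v))"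


section \<open>A random access machine with output instruction\<close>

text \<open>
  Algorithms are structured programs for a random access machine with indirect addressing.  The
  memory consists of named arrays of natural numbers; \<open>Cell x (Num 0)\<close> serves as a scalar
  variable.  The arithmetic operations are addition and truncated subtraction; multiplication is
  deliberately not a primitive.  As is usual for enumeration algorithms on such machines, one
  instruction, \<open>Output x e\<close>, outputs a whole solution, namely the first \<open>e\<close> entries of the
  array \<open>x\<close>.
\<close>

type_synonym mem = "string \<Rightarrow> nat \<Rightarrow> nat"

datatype aexp = Num nat | Cell string aexp | Plus aexp aexp | Minus aexp aexp

datatype bexp = Less aexp aexp | Not bexp | And bexp bexp

datatype com =
    Assign string aexp aexp
  | Output string aexp
  | Seq com com
  | If bexp com com
  | While bexp com

primrec aval :: "aexp \<Rightarrow> mem \<Rightarrow> nat" where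
  "aval (Num k) s = k"
| "aval (Cell x i) s = s x (aval i s)"
| "aval (Plus a b) s = aval a s + aval b s"
| "aval (Minus a b) s = aval a s - aval b s"

primrec bval :: "bexp \<Rightarrow> mem \<Rightarrow> bool" where
  "bval (Less a b) s \<longleftrightarrow> aval a s < aval b s"
| "bval (Not b) s \<longleftrightarrow> \<not> bval b s"
| "bval (And b c) s \<longleftrightarrow> bval b s \<and> bval c s"

text \<open>
  A configuration consists of the stack of commands still to be executed and the memory.  There
  are no procedures, so for a fixed program the stack takes only finitely many values.
\<close>

type_synonym config = "com list \<times> mem"

fun step :: "config \<Rightarrow> config" where
  "step ([], s) = ([], s)"
| "step (Assign x i e # K, s) = (K, s(x := (s x)(aval i s := aval e s)))"
| "step (Output x e # K, s) = (K, s)"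
| "step (Seq c d # K, s) = (c # d # K, s)"
| "step (If b c d # K, s) = ((if bval b s then c else d) # K, s)"
| "step (While b c # K, s) = (if bval b s then c # While b c # K else K, s)"

text \<open>The solution that is output when the next step is made from the given configuration.\<close>

fun emitted :: "config \<Rightarrow> nat list option" where
  "emitted (Output x e # K, s) = Some (map (s x) [0..<aval e s])"
| "emitted _ = None"

definition run :: "com \<Rightarrow> mem \<Rightarrow> nat \<Rightarrow> config" where
  "run c s t = (step ^^ t) ([c], s)"

text \<open>\<open>halts_at c s T\<close>: the running time of \<open>c\<close> on \<open>s\<close> is \<open>T\<close>.\<close>

definition halts_at :: "com \<Rightarrow> mem \<Rightarrow> nat \<Rightarrow> bool" where
  "halts_at c s T \<longleftrightarrow> fst (run c s T) = [] \<and> (\<forall>t<T. fst (run c s t) \<noteq> [])"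

definition outputs :: "com \<Rightarrow> mem \<Rightarrow> nat \<Rightarrow> nat list list" where
  "outputs c s T = List.map_filter (\<lambda>t. emitted (run c s t)) [0..<T]"

definition output_times :: "com \<Rightarrow> mem \<Rightarrow> nat \<Rightarrow> nat list" where
  "output_times c s T = map Suc (filter (\<lambda>t. emitted (run c s t) \<noteq> None) [0..<T])"

text \<open>
  The time before the first output, the times between consecutive outputs, and the time from the
  last output until termination (just \<open>[T]\<close> if there is no output).
\<close>

definition delays :: "com \<Rightarrow> mem \<Rightarrow> nat \<Rightarrow> nat list" where
  "delays c s T = map2 (-) (output_times c s T @ [T]) (0 # output_times c s T)"

text \<open>
  Space is measured in bits: every nonzero cell accounts for its address and its content.  Hence
  a program within polynomial space only handles numbers of polynomially many bits, and charging
  unit cost per step agrees with bit cost up to a polynomial factor.  The solutions that have been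
  output do not occupy space.
\<close>

definition support :: "mem \<Rightarrow> (string \<times> nat) set" where
  "support s = {(x, i). s x i \<noteq> 0}"

definition space :: "mem \<Rightarrow> nat" where
  "space s = (\<Sum>(x, i)\<in>support s. 1 + floorlog 2 i + floorlog 2 (s x i))"

text \<open>
  The input is a graph on the vertices \<open>0, \<dots>, n - 1\<close>, presented by \<open>n\<close> and its adjacency matrix,
  stored row by row.  An interval representation is not part of the input.
\<close>

definition input_mem :: "nat \<Rightarrow> nat pair_pre_digraph \<Rightarrow> mem" where
  "input_mem n G = (\<lambda>_ _. 0)
     (''n'' := (\<lambda>_. 0)(0 := n),
      ''adj'' := (\<lambda>k. if \<exists>i<n. \<exists>j<n. k = i * n + j \<and> (i, j) \<in> parcs G then 1 else 0))"

text \<open>The sum in \<open>space\<close> is never over an infinite set.\<close>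

lemma finite_support_input: "finite (support (input_mem n G))"
proof (rule finite_subset)
  show "support (input_mem n G) \<subseteq>
      insert (''n'', 0) ((\<lambda>(i, j). (''adj'', i * n + j)) ` ({..<n} \<times> {..<n}))"
    by (auto simp: support_def input_mem_def split: if_splits)
qed simp

lemma finite_support_step:
  assumes "finite (support (snd k))"
  shows "finite (support (snd (step k)))"
proof -
  have "finite (support (s(x := (s x)(i := a))))" if "finite (support s)" for s x i a
    by (rule finite_subset[of _ "insert (x, i) (support s)"])
      (use that in \<open>auto simp: support_def split: if_splits\<close>)
  with assms show ?thesis
    by (cases k rule: step.cases) auto
qed

lemma finite_support_run: "finite (support (snd (run c (input_mem n G) t)))"
  by (induction t) (auto simp: run_def finite_support_input finite_support_step)

end

theory Submission imports Defs begin

text \<open>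
  A minimal Roman dominating function is determined by the set \<open>S\<close> of vertices of value \<open>2\<close>, and
  the sets that occur are exactly the open irredundant ones: every \<open>v \<in> S\<close> has a neighbour
  outside \<open>S\<close> that has no other neighbour in \<open>S\<close>.  This property is inherited by subsets.  Hence
  backtracking over the vertices, which extends the current set by larger vertices only, never runs
  into a dead end: every set it visits is output.  This gives polynomial delay and space on any graph,
  and the running time is the number of open irredundant sets up to a polynomial factor.

  On interval graphs there are at most \<open>(n + 1) * sqrt 3 ^ n\<close> of them.  Remove from \<open>S\<close> the interval
  \<open>s\<close> that ends first, and let \<open>p\<close> be the neighbour of \<open>s\<close> that ends first among those that can
  still be private.  All other members of \<open>S\<close> begin after the end of \<open>p\<close>, and their private
  neighbours begin after the end of \<open>s\<close>.  So a subproblem is given by two thresholds, one for the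
  candidate members of \<open>S\<close> and one for the candidate private neighbours.  Weighting these by
  \<open>sqrt 2\<close> and \<open>sqrt (3/2)\<close>, whose product is \<open>sqrt 3\<close>, one shows that the weights of the subproblems
  of one branching step add up to at most the weight of the problem.
\<close>

section \<open>Counting open irredundant sets of intervals\<close>

text \<open>The base \<open>sqrt 3\<close> is forced: n/2 disjoint edges have
  \<open>sqrt 3 ^ n\<close> open irredundant sets, three for each edge, so the estimates must lose
  nothing on an edge. The private neighbour that s really has may end later than p. Using p anyway
  only enlarges the subproblem and makes it depend on s alone, so there is one branch for each s.
  The obstacle is that an interval can lose one of its two roles and keep the other. Intervals that
  begin between the thresholds can still be private but are no longer members; those that contain
  the end of s can be members but not private. This is why each role has its own weight, and why the
  sum over s is estimated by an induction in which the threshold a moves to the right while b stays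
  fixed. The running time needs no analysis of its own: it is at most the delay times one more than
  the number of outputs. The machine has no recursion, so the search is a single loop with a stack,
  and segments of its run are compared with a recursively defined list of sets.\<close>

text \<open>
  The inequalities below leave little room for other ways to split \<open>sqrt 3\<close>; this one has rational
  squares.
\<close>

definition wC :: real where "wC = sqrt 2"
definition wD :: real where "wD = sqrt (3/2)"

section \<open>Numerical inequalities for the two weights\<close>

lemma wC_bounds: "1414/1000 < wC" "wC < 14143/10000"
  unfolding wC_def
  by (rule real_less_rsqrt, simp add: power2_eq_square)
    (rule real_less_lsqrt, auto simp: power2_eq_square)

lemma wD_bounds: "12247/10000 < wD" "wD < 12248/10000"
  unfolding wD_def
  by (rule real_less_rsqrt, simp add: power2_eq_square)
    (rule real_less_lsqrt, auto simp: power2_eq_square)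

lemma weights_pos [simp]: "0 < wC" "0 < wD" "wC \<noteq> 0" "wD \<noteq> 0" "0 \<le> wC" "0 \<le> wD" "1 \<le> wC" "1 \<le> wD"
  using wC_bounds wD_bounds by auto

lemma weight_products:
  "wC * wC = 2" "wD * wD = 3/2" "wC * wD = sqrt 3"
  by (simp_all add: wC_def wD_def flip: real_sqrt_mult)

lemma weight_products_left:
  "wC * (wC * x) = 2 * x" "wD * (wD * x) = 3/2 * x"
  by (simp_all add: weight_products flip: mult.assoc)

lemma sqrt3_power_split: "sqrt 3 ^ m = wC ^ m * wD ^ m"
  by (simp flip: weight_products power_mult_distrib)

lemma sqrt3_bounds: "1732/1000 < sqrt (3::real)" "sqrt (3::real) < 17321/10000"
  by (rule real_less_rsqrt, simp add: power2_eq_square)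
    (rule real_less_lsqrt, auto simp: power2_eq_square)

lemma wD_power_ge1: "1 \<le> wD ^ q"
  using wD_bounds by (intro one_le_power) simp

lemma wC_power_ge1: "1 \<le> wC ^ q"
  using wC_bounds by (intro one_le_power) simp

text \<open>Two more factors \<open>wC\<close> double the right-hand side while the left-hand side
  grows by 2, so the induction goes in steps of two. Only from 0 to 2 is doubling not enough; there
  3 \<le> 2 * sqrt 3 helps. In \<open>branching_le\<close>, q counts the candidates that contain the
  threshold b.\<close>

lemma linear_le_wC_power: "1 + real q \<le> sqrt 3 * wC ^ q"
proof (induction q rule: less_induct)
  case (less q)
  show ?case
  proof (cases "q < 2")
    case True
    then have "q = 0 \<or> q = 1" by auto
    moreover have "sqrt 3 * wC > 1.732 * 1.414"
      using sqrt3_bounds wC_bounds by (intro mult_strict_mono) auto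
    ultimately show ?thesis
      using sqrt3_bounds by auto
  next
    case False
    then obtain p where q: "q = p + 2" by (metis add.commute le_Suc_ex not_less)
    have "1 + real p \<le> sqrt 3 * wC ^ p" using less q by simp
    moreover have "wC ^ q = 2 * wC ^ p"
      using q by (simp add: power_add power2_eq_square weight_products)
    moreover have "3 \<le> 2 * sqrt (3::real)"
      using sqrt3_bounds by linarith
    ultimately show ?thesis using q by (cases "p = 0") (auto simp: weight_products_left)
  qed
qed

text \<open>Bernoulli's inequality makes the claim linear in q. What remains is sqrt 3 * (2 - wC)
  \<ge> 1, which holds with a margin below two percent.\<close>

lemma crossing_le_wC_power: "wC * sqrt 3 + real q \<le> wC * sqrt 3 * wC ^ q"
proof -
  have "1 + real q * (wC - 1) \<le> wC ^ q"
    using Bernoulli_inequality[of "wC - 1" q] by simp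
  then have "wC * sqrt 3 * (1 + real q * (wC - 1)) \<le> wC * sqrt 3 * wC ^ q"
    by (intro mult_left_mono) auto
  moreover have "1 \<le> wC * sqrt 3 * (wC - 1)"
  proof -
    have "1.732 * (2 - 1.4143) \<le> sqrt 3 * (2 - wC)"
      using sqrt3_bounds wC_bounds by (intro mult_mono) auto
    then show ?thesis by (simp add: algebra_simps weight_products_left)
  qed
  then have "real q * 1 \<le> real q * (wC * sqrt 3 * (wC - 1))"
    by (intro mult_left_mono) auto
  ultimately show ?thesis by (simp add: algebra_simps)
qed

text \<open>After division by \<open>sqrt 3 ^ m\<close>, the 1 + t members of the clique in
  \<open>weighted_sum_le\<close> weigh at most 1 each, and at most t of them join the q useful
  intervals for the rest. For t = 1 and q = 0 this would read 2 + wD \<le> 3, which is false; that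
  case is settled by geometry instead.\<close>

lemma clique_ineq:
  assumes "t \<ge> 1" "\<not> (t = 1 \<and> q = 0)"
  shows "1 + real t + wD ^ (q + t) \<le> sqrt 3 ^ Suc t * wD ^ q"
proof (cases "t = 1")
  case True
  then obtain p where q: "q = Suc p" using assms by (cases q) auto
  have "2 \<le> (3 - wD) * wD"
    using wD_bounds by (simp add: algebra_simps weight_products)
  also have "\<dots> * 1 \<le> (3 - wD) * wD * wD ^ p"
    using wD_power_ge1[of p] wD_bounds by (intro mult_left_mono) auto
  finally show ?thesis using q True by (simp add: algebra_simps weight_products_left)
next
  case False
  have "1 + real t + wD ^ t \<le> sqrt 3 ^ Suc t" if "t \<ge> 2" for t
    using that
  proof (induction t rule: dec_induct)
    case base
    then show ?case using sqrt3_bounds by (simp add: eval_nat_numeral weight_products)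
  next
    case (step t)
    have "1 + real (Suc t) + wD ^ Suc t \<le> 1732/1000 * (1 + real t + wD ^ t)"
    proof -
      have "wD ^ Suc t \<le> 13/10 * wD ^ t"
        using wD_bounds by simp
      moreover have "2 \<le> real t"
        using step(1) by simp
      moreover have "1 + (1 + u) + x \<le> 1732/1000 * (1 + u + y)"
        if "x \<le> 13/10 * y" "2 \<le> u" "1 \<le> y" for u x y :: real
        using that by simp
      ultimately show ?thesis
        using wD_power_ge1[of t] unfolding of_nat_Suc by blast
    qed
    also have "\<dots> \<le> sqrt 3 * sqrt 3 ^ Suc t"
      using step sqrt3_bounds wD_power_ge1[of t] by (intro mult_mono) auto
    finally show ?case by simp
  qed
  then have "(1 + real t + wD ^ t) * wD ^ q \<le> sqrt 3 ^ Suc t * wD ^ q"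
    using False assms by (intro mult_right_mono) auto
  moreover have "1 + real t \<le> (1 + real t) * wD ^ q"
    using mult_left_mono[OF wD_power_ge1[of q], of "1 + real t"] by simp
  ultimately show ?thesis by (simp add: algebra_simps power_add)
qed

text \<open>The counterpart of \<open>clique_ineq\<close> for weights that increase along the
  clique. One of the t + 2 factors \<open>wD\<close> on the right comes from a useful interval that
  is used up in the step.\<close>

lemma staircase_ineq:
  assumes "t \<ge> 1"
  shows "(\<Sum>k\<le>t. wC ^ k) + wD ^ t \<le> wC ^ Suc t * wD ^ (t + 2)"
proof -
  \<comment> \<open>Shifting the geometric sum produces an extra 1, which the factor
    \<open>sqrt 3 - wC\<close> has to absorb; for this the right-hand side must stay away from 0. At
    t = 1 it is about 3.674.\<close>
  have "(\<Sum>k\<le>t. wC ^ k) + wD ^ t \<le> wC ^ Suc t * wD ^ (t + 2) \<and> 3.67 \<le> wC ^ Suc t * wD ^ (t + 2)"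
    using assms
  proof (induction t rule: dec_induct)
    case base
    then show ?case using wC_bounds wD_bounds by (simp add: eval_nat_numeral weight_products weight_products_left)
  next
    case (step t)
    let ?L = "(\<Sum>k\<le>t. wC ^ k) + wD ^ t" and ?R = "wC ^ Suc t * wD ^ (t + 2)"
    have "(\<Sum>k\<le>Suc t. wC ^ k) + wD ^ Suc t = 1 + wC * (\<Sum>k\<le>t. wC ^ k) + wD * wD ^ t"
      by (subst sum.atMost_Suc_shift) (simp add: sum_distrib_left)
    also have "\<dots> \<le> 1 + wC * ?L"
      using wC_bounds wD_bounds
      by (auto simp: distrib_left intro!: mult_right_mono)
    also have "\<dots> \<le> 1 + wC * ?R"
      using step by (intro add_left_mono mult_left_mono) auto
    also have "1 + wC * ?R \<le> sqrt 3 * ?R"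
    proof -
      have "0.3177 * 3.67 \<le> (sqrt 3 - wC) * ?R"
        using step sqrt3_bounds wC_bounds by (intro mult_mono) auto
      then show ?thesis by (simp add: algebra_simps)
    qed
    finally have *: "(\<Sum>k\<le>Suc t. wC ^ k) + wD ^ Suc t \<le> sqrt 3 * ?R" .
    have "1 * 3.67 \<le> sqrt 3 * ?R"
      using step sqrt3_bounds by (intro mult_mono) auto
    moreover have "sqrt 3 * ?R = wC ^ Suc (Suc t) * wD ^ (Suc t + 2)"
      by (simp add: ac_simps flip: weight_products(3))
    ultimately show ?case using * unfolding mult_1 by metis
  qed
  then show ?thesis ..
qed

text \<open>If \<open>l\<close> is injective on N, the ranks are 1, ..., card N. Ties only raise
  ranks, and x \<le> 1 then shrinks the terms. An element with the largest \<open>l\<close> has rank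
  card N, and removing it raises no other rank.\<close>

lemma sum_power_rank_le:
  fixes l :: "'a \<Rightarrow> real" and x :: real
  assumes "finite N" "0 \<le> x" "x \<le> 1"
  shows "(\<Sum>s\<in>N. x ^ card {v\<in>N. l v \<le> l s}) \<le> (\<Sum>k=1..card N. x ^ k)"
  using assms(1)
proof (induction "card N" arbitrary: N)
  case 0
  then show ?case by simp
next
  case (Suc m)
  then have "N \<noteq> {}" by auto
  have "Max (l ` N) \<in> l ` N"
    using \<open>N \<noteq> {}\<close> Suc(3) by (intro Max_in) auto
  then obtain u where "u \<in> N" "l u = Max (l ` N)" by force
  then have u: "u \<in> N" "\<And>v. v \<in> N \<Longrightarrow> l v \<le> l u"
    using Suc(3) by auto
  have m: "card (N - {u}) = m" using Suc u by simp
  have "(\<Sum>s\<in>N. x ^ card {v\<in>N. l v \<le> l s}) =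
      x ^ card {v\<in>N. l v \<le> l u} + (\<Sum>s\<in>N-{u}. x ^ card {v\<in>N. l v \<le> l s})"
    using Suc u by (subst sum.remove[of _ u]) auto
  also have "{v\<in>N. l v \<le> l u} = N" using u by auto
  also have "(\<Sum>s\<in>N-{u}. x ^ card {v\<in>N. l v \<le> l s}) \<le>
      (\<Sum>s\<in>N-{u}. x ^ card {v\<in>N-{u}. l v \<le> l s})"
    using assms Suc by (intro sum_mono power_decreasing card_mono) auto
  also have "\<dots> \<le> (\<Sum>k=1..m. x ^ k)"
    using Suc(1)[of "N - {u}"] m Suc(3) by simp
  finally show ?case using Suc(2)[symmetric] by (simp add: sum.nat_ivl_Suc')
qed

text \<open>Factoring out the largest power turns the subtracted rank into a power of 1 / wC, so
  that \<open>sum_power_rank_le\<close> applies although wC > 1.\<close>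

lemma sum_wC_rank_le:
  fixes l :: "'a \<Rightarrow> real"
  assumes "finite N" "card N = Suc t"
  shows "(\<Sum>s\<in>N. wC ^ (M + Suc t - card {v\<in>N. l v \<le> l s})) \<le> wC ^ M * (\<Sum>k\<le>t. wC ^ k)"
proof -
  have le: "card {v\<in>N. l v \<le> l s} \<le> Suc t" for s
    using assms by (metis (no_types, lifting) card_mono mem_Collect_eq subsetI)
  have "(\<Sum>s\<in>N. wC ^ (M + Suc t - card {v\<in>N. l v \<le> l s})) =
      wC ^ (M + Suc t) * (\<Sum>s\<in>N. (1 / wC) ^ card {v\<in>N. l v \<le> l s})"
    unfolding sum_distrib_left
  proof (rule sum.cong)
    fix s
    show "wC ^ (M + Suc t - card {v\<in>N. l v \<le> l s}) =
        wC ^ (M + Suc t) * (1 / wC) ^ card {v\<in>N. l v \<le> l s}"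
      using le[of s] by (subst power_diff) (auto simp: power_divide)
  qed simp
  also have "\<dots> \<le> wC ^ (M + Suc t) * (\<Sum>k=1..Suc t. (1 / wC) ^ k)"
    using sum_power_rank_le[of N "1 / wC" l] assms by (intro mult_left_mono) auto
  also have "\<dots> = (\<Sum>k=1..Suc t. wC ^ M * wC ^ (Suc t - k))"
    unfolding sum_distrib_left
  proof (rule sum.cong)
    fix k assume "k \<in> {1..Suc t}"
    then show "wC ^ (M + Suc t) * (1 / wC) ^ k = wC ^ M * wC ^ (Suc t - k)"
      by (subst power_diff) (auto simp: power_divide power_add)
  qed simp
  also have "\<dots> = wC ^ M * (\<Sum>k=1..Suc t. wC ^ (Suc t - k))"
    by (rule sum_distrib_left [symmetric])
  also have "(\<Sum>k\<in>{1..Suc t}. wC ^ (Suc t - k)) = (\<Sum>k\<le>t. wC ^ k)"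
    using sum.nat_diff_reindex[of "\<lambda>k. wC ^ k" "Suc t"]
    by (simp add: sum.atLeast1_atMost_eq flip: lessThan_Suc_atMost)
  finally show ?thesis .
qed

section \<open>Subproblems given by two thresholds, and their weights\<close>

locale interval_family =
  fixes V :: "'a set" and l r :: "'a \<Rightarrow> real"
  assumes finite_V: "finite V" and l_le_r: "v \<in> V \<Longrightarrow> l v \<le> r v"
begin

text \<open>The possible members: they miss the private neighbours chosen so far, hence begin after
  a, and they end after b because members are removed in the order of their ends.\<close>

definition cands :: "real \<Rightarrow> real \<Rightarrow> 'a set" where
  "cands a b = {v\<in>V. a < l v \<and> b < r v}"

definition privs :: "real \<Rightarrow> 'a set" where
  "privs b = {v\<in>V. b < l v}"

definition nbrs :: "real \<Rightarrow> 'a \<Rightarrow> 'a set" where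
  "nbrs b s = {p\<in>V. p \<noteq> s \<and> b < l p \<and> l p \<le> r s \<and> l s \<le> r p}"

text \<open>The minimum of the empty set is unspecified, so all sums over s are restricted to
  \<open>nbrs b s \<noteq> {}\<close>.\<close>

definition first_end :: "real \<Rightarrow> 'a \<Rightarrow> real" where
  "first_end b s = Min (r ` nbrs b s)"

text \<open>Up to a linear factor, this bounds the number of sets in the subproblem that remains
  once s is removed.\<close>

definition wt :: "real \<Rightarrow> 'a \<Rightarrow> real" where
  "wt b s = wC ^ card (cands (first_end b s) (r s)) * wD ^ card (privs (r s))"

text \<open>
  If \<open>b \<le> a\<close>, these are the intervals that can still serve as private neighbours although they can
  no longer be members of the set.
\<close>

definition useful :: "real \<Rightarrow> real \<Rightarrow> 'a set" where
  "useful a b = {z\<in>V. b < l z \<and> l z \<le> a \<and> (\<exists>v\<in>V. a < l v \<and> l v \<le> r z)}"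

lemma finite_sets [simp]:
  "finite (cands a b)" "finite (privs b)" "finite (nbrs b s)" "finite (useful a b)"
  using finite_V by (auto simp: cands_def privs_def nbrs_def useful_def)

lemma first_end_in:
  assumes "nbrs b s \<noteq> {}"
  obtains p where "p \<in> nbrs b s" "first_end b s = r p"
proof -
  have "first_end b s \<in> r ` nbrs b s"
    unfolding first_end_def using assms by (intro Min_in) auto
  then show ?thesis using that by auto
qed

lemma first_end_le: "p \<in> nbrs b s \<Longrightarrow> first_end b s \<le> r p"
  unfolding first_end_def by (intro Min_le) auto

lemma l_le_first_end: "nbrs b s \<noteq> {} \<Longrightarrow> l s \<le> first_end b s"
  by (rule first_end_in[of b s]) (auto simp: nbrs_def)

lemma wt_nonneg [simp]: "0 \<le> wt b s"
  by (simp add: wt_def)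

lemma wt_le:
  assumes "card (cands (first_end b s) (r s)) \<le> m" "card (privs (r s)) \<le> k"
  shows "wt b s \<le> wC ^ m * wD ^ k"
  unfolding wt_def using assms by (intro mult_mono power_increasing) auto

lemma obtain_first:
  assumes "privs a \<noteq> {}"
  obtains f where "f \<in> privs a" "\<And>v. v \<in> privs a \<Longrightarrow> r f \<le> r v"
proof -
  have "Min (r ` privs a) \<in> r ` privs a"
    using assms by (intro Min_in) auto
  then obtain f where "f \<in> privs a" "r f = Min (r ` privs a)" by force
  then show ?thesis using that[of f] by auto
qed

text \<open>
  The induction removes the clique \<open>N\<close> of intervals that meet the interval \<open>f\<close> ending first.  Apart
  from \<open>f\<close>, these turn into useful intervals, which is paid for by the factor \<open>wD ^ card (useful a b)\<close>.
  The tightest case is that \<open>N\<close> has two elements.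
\<close>

lemma weighted_sum_le:
  assumes "b \<le> a"
  shows "(\<Sum>s | s \<in> privs a \<and> nbrs b s \<noteq> {}. wt b s)
    \<le> sqrt 3 ^ card (privs a) * wD ^ card (useful a b)"
  using assms
proof (induction "card (privs a)" arbitrary: a rule: less_induct)
  case less
  show ?case
  proof (cases "privs a = {}")
    case True
    then show ?thesis by simp
  next
    case False
    obtain f where f: "f \<in> privs a" and f_min: "\<And>v. v \<in> privs a \<Longrightarrow> r f \<le> r v"
      using obtain_first[OF False] by metis
    have fV: "f \<in> V" "a < l f" "l f \<le> r f" using f l_le_r by (auto simp: privs_def)
    define N where "N = {v\<in>privs a. l v \<le> r f}"
    have fN: "f \<in> N" using f fV by (simp add: N_def)
    have [simp]: "finite N" by (simp add: N_def)
    obtain t where t: "card N = Suc t"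
      using fN by (metis \<open>finite N\<close> card_0_eq empty_iff not0_implies_Suc)
    define m where "m = card (privs (r f))"
    have split: "privs a = N \<union> privs (r f)" "N \<inter> privs (r f) = {}"
      using fV by (auto simp: N_def privs_def)
    then have card_a: "card (privs a) = Suc t + m"
      using t by (simp add: card_Un_disjoint m_def)
    define q where "q = card (useful a b)"
    define q' where "q' = card (useful (r f) b)"
    define adm where "adm = (\<lambda>s. nbrs b s \<noteq> {})"
    have sum_split: "(\<Sum>s | s \<in> privs a \<and> nbrs b s \<noteq> {}. wt b s) =
        (\<Sum>s | s \<in> N \<and> adm s. wt b s) + (\<Sum>s | s \<in> privs (r f) \<and> adm s. wt b s)"
      using split by (subst sum.union_disjoint [symmetric]) (auto intro!: sum.cong simp: adm_def)
    have rest: "(\<Sum>s | s \<in> privs (r f) \<and> adm s. wt b s) \<le> sqrt 3 ^ m * wD ^ q'"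
      unfolding m_def q'_def adm_def using card_a fV less.prems
      by (intro less.hyps) (auto simp: m_def)
    have privs_le: "card (privs (r s)) \<le> m" if "s \<in> N" for s
    proof -
      have "r f \<le> r s" using f_min that by (simp add: N_def)
      then have "privs (r s) \<subseteq> privs (r f)" by (auto simp: privs_def)
      then show ?thesis by (simp add: m_def card_mono)
    qed
    have cands_le: "card (cands \<rho> c) \<le> m" if "r f \<le> \<rho>" for \<rho> c
    proof -
      have "cands \<rho> c \<subseteq> privs (r f)" using that by (auto simp: privs_def cands_def)
      then show ?thesis by (simp add: m_def card_mono)
    qed
    show ?thesis
    proof (cases "t = 0")
      case True
      then have N: "N = {f}" using t fN by (metis One_nat_def card_1_singletonE singletonD)
      have sub: "useful (r f) b \<subseteq> useful a b"
      proof
        fix z assume z: "z \<in> useful (r f) b"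
        then have "z \<noteq> f" by (auto simp: useful_def)
        then have "l z \<le> a"
          using z N by (force simp: useful_def N_def privs_def)
        then show "z \<in> useful a b" using z fV by (force simp: useful_def)
      qed
      then have q'_le: "q' \<le> q" unfolding q_def q'_def by (intro card_mono) auto
      have f_cands: "cands (first_end b f) (r f) \<subseteq> privs (r f)" if "adm f"
      proof
        fix v assume v: "v \<in> cands (first_end b f) (r f)"
        have "l f \<le> first_end b f" using that l_le_first_end by (simp add: adm_def)
        then have "v \<in> privs a" using v fV by (auto simp: cands_def privs_def)
        moreover have "v \<noteq> f" using v by (auto simp: cands_def)
        ultimately show "v \<in> privs (r f)" using N split by auto
      qed
      have "(\<Sum>s | s \<in> N \<and> adm s. wt b s) + sqrt 3 ^ m * wD ^ q' \<le> sqrt 3 ^ Suc m * wD ^ q"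
      proof (cases "adm f")
        case False
        then have e: "{s. s \<in> N \<and> adm s} = {}" using N by auto
        have "1 * (sqrt 3 ^ m * wD ^ q') \<le> sqrt 3 * (sqrt 3 ^ m * wD ^ q)"
          using q'_le sqrt3_bounds by (intro mult_mono power_increasing) auto
        then show ?thesis unfolding e by (simp add: mult.assoc)
      next
        case adm: True
        then have e: "{s. s \<in> N \<and> adm s} = {f}" using N by auto
        obtain z where z: "z \<in> nbrs b f" "first_end b f = r z"
          using adm first_end_in[of b f] unfolding adm_def by metis
        have "z \<notin> N" using N z by (auto simp: nbrs_def)
        then have za: "l z \<le> a"
          using z by (force simp: nbrs_def N_def privs_def)
        then have zU: "z \<in> useful a b" using z fV by (auto simp: nbrs_def useful_def)
        \<comment> \<open>The reach of z decides what is paid. If z meets an interval v beyond f,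
          then v is lost as a candidate, and 1 \<le> (sqrt 3 - 1) * wC suffices. Otherwise z is not
          useful for the remaining sum, and 2 \<le> sqrt 3 * wD suffices.\<close>
        show ?thesis
        proof (cases "\<exists>v\<in>V. r f < l v \<and> l v \<le> r z")
          case True
          then obtain v where v: "v \<in> V" "r f < l v" "l v \<le> r z" by auto
          then have vp: "v \<in> privs (r f)" by (simp add: privs_def)
          then obtain m1 where m1: "m = Suc m1"
            unfolding m_def by (metis card_gt_0_iff emptyE finite_sets(2) gr0_implies_Suc)
          have "cands (first_end b f) (r f) \<subseteq> privs (r f) - {v}"
            using f_cands[OF adm] v z by (auto simp: cands_def)
          then have "card (cands (first_end b f) (r f)) \<le> card (privs (r f) - {v})"
            by (intro card_mono) auto
          also have "\<dots> = m1" using vp m1 m_def by simp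
          finally have "wt b f \<le> wC ^ m1 * wD ^ m"
            using privs_le[OF fN] by (intro wt_le)
          moreover have "wC ^ m1 * wD ^ m \<le> (sqrt 3 - 1) * sqrt 3 ^ m"
          proof -
            have "1 \<le> (sqrt 3 - 1) * wC"
            proof -
              have "(732/1000) * (1414/1000) \<le> (sqrt 3 - 1) * wC"
                using sqrt3_bounds wC_bounds by (intro mult_mono) auto
              then show ?thesis by simp
            qed
            then have "1 * (wC ^ m1 * wD ^ m) \<le> (sqrt 3 - 1) * wC * (wC ^ m1 * wD ^ m)"
              by (intro mult_right_mono) auto
            also have "\<dots> = (sqrt 3 - 1) * sqrt 3 ^ m"
              unfolding sqrt3_power_split by (simp add: m1)
            finally show ?thesis by simp
          qed
          moreover have "(sqrt 3 - 1) * sqrt 3 ^ m * 1 \<le> (sqrt 3 - 1) * sqrt 3 ^ m * wD ^ q"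
            using wD_power_ge1[of q] sqrt3_bounds by (intro mult_left_mono) auto
          moreover have "sqrt 3 ^ m * wD ^ q' \<le> sqrt 3 ^ m * wD ^ q"
            using q'_le by (intro mult_left_mono power_increasing) auto
          ultimately have "wt b f + sqrt 3 ^ m * wD ^ q' \<le>
              (sqrt 3 - 1) * sqrt 3 ^ m * wD ^ q + sqrt 3 ^ m * wD ^ q"
            by linarith
          also have "\<dots> = sqrt 3 ^ Suc m * wD ^ q" by (simp add: algebra_simps)
          finally show ?thesis unfolding e by simp
        next
          case False
          then have "z \<notin> useful (r f) b" by (auto simp: useful_def)
          then have "useful (r f) b \<subseteq> useful a b - {z}" using sub by auto
          then have "q' \<le> card (useful a b - {z})"
            unfolding q'_def by (intro card_mono) auto
          moreover obtain p where p: "q = Suc p"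
            using zU unfolding q_def
            by (metis card_gt_0_iff emptyE finite_sets(4) gr0_implies_Suc)
          ultimately have q'_le: "q' \<le> p" using zU by (simp add: q_def)
          have "wt b f \<le> wC ^ m * wD ^ m"
            using privs_le[OF fN] f_cands[OF adm] unfolding m_def
            by (intro wt_le card_mono) auto
          then have "wt b f \<le> sqrt 3 ^ m * 1" by (simp add: sqrt3_power_split)
          also have "\<dots> \<le> sqrt 3 ^ m * wD ^ p"
            using wD_power_ge1 by (intro mult_left_mono) auto
          finally have 1: "wt b f \<le> sqrt 3 ^ m * wD ^ p" .
          have "sqrt 3 ^ m * wD ^ q' \<le> sqrt 3 ^ m * wD ^ p"
            using q'_le by (intro mult_left_mono power_increasing) auto
          with 1 have "wt b f + sqrt 3 ^ m * wD ^ q' \<le> 2 * (sqrt 3 ^ m * wD ^ p)"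
            by linarith
          also have "\<dots> \<le> (sqrt 3 * wD) * (sqrt 3 ^ m * wD ^ p)"
          proof (intro mult_right_mono)
            have "(1732/1000) * (12247/10000) \<le> sqrt 3 * wD"
              using sqrt3_bounds wD_bounds by (intro mult_mono) auto
            then show "2 \<le> sqrt 3 * wD" by simp
          qed auto
          finally show ?thesis unfolding e by (simp add: p ac_simps)
        qed
      qed
      then show ?thesis using sum_split rest card_a True by (simp add: q_def)
    next
      case False
      \<comment> \<open>useful intervals that end before \<open>f\<close> cannot be used after this step\<close>
      define Y where "Y = {z\<in>useful a b. r z < r f}"
      \<comment> \<open>Since f ends exactly at the new threshold, it meets nothing that begins
        later; only the other t members of N can become useful.\<close>
      have useful_sub: "useful (r f) b \<subseteq> (useful a b - Y) \<union> (N - {f})"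
      proof
        fix z assume z: "z \<in> useful (r f) b"
        have "z \<noteq> f" "z \<notin> Y" using z by (auto simp: useful_def Y_def)
        moreover have "z \<in> useful a b \<or> z \<in> N"
          using z fV by (force simp: useful_def N_def privs_def)
        ultimately show "z \<in> (useful a b - Y) \<union> (N - {f})" by auto
      qed
      have Y_sub: "Y \<subseteq> useful a b" by (auto simp: Y_def)
      have "q' \<le> card ((useful a b - Y) \<union> (N - {f}))"
        unfolding q'_def using useful_sub by (intro card_mono) auto
      also have "\<dots> \<le> card (useful a b - Y) + card (N - {f})"
        by (rule card_Un_le)
      also have "\<dots> = q - card Y + t"
        using t fN Y_sub by (simp add: q_def card_Diff_subset finite_subset)
      finally have q'_le: "q' \<le> q - card Y + t" .
      show ?thesis
      proof (cases "Y = {}")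
        case Y: True
        \<comment> \<open>A possible private neighbour of s that begins after a ends no earlier than
          f by the choice of f; one that begins before is useful, and Y is empty.\<close>
        have end_ge: "r f \<le> first_end b s" if s: "s \<in> N" "adm s" for s
        proof -
          obtain z where z: "z \<in> nbrs b s" "first_end b s = r z"
            using s first_end_in[of b s] unfolding adm_def by metis
          show ?thesis
          proof (cases "a < l z")
            case True
            then show ?thesis using z f_min by (auto simp: nbrs_def privs_def)
          next
            case False
            then have "z \<in> useful a b"
              using z s by (force simp: nbrs_def useful_def N_def privs_def)
            then show ?thesis using Y z by (force simp: Y_def)
          qed
        qed
        show ?thesis
        proof (cases "t = 1 \<and> q = 0")
          case True
          then obtain u where N: "N = {f, u}" "u \<noteq> f"
            using t fN by (metis One_nat_def card_2_iff' insertE insert_absorb2 numeral_2_eq_2 singletonD card_2_iff doubleton_eq_iff)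
          have uV: "u \<in> V" "a < l u" "l u \<le> r f" "r f \<le> r u"
            using N f_min by (auto simp: N_def privs_def)
          have U0: "useful a b = {}" using True by (simp add: q_def)
          \<comment> \<open>The exception to \<open>clique_ineq\<close>. With nothing useful, f can
            only have u as private neighbour. So the intervals in E are lost twice: as candidates
            after f, because they meet u, and as private neighbours after u.\<close>
          define E where "E = {v\<in>V. r f < l v \<and> l v \<le> r u}"
          define e where "e = card E"
          have E_sub: "E \<subseteq> privs (r f)" by (auto simp: E_def privs_def)
          have [simp]: "finite E" using finite_V by (simp add: E_def)
          have "privs (r u) = privs (r f) - E" using uV by (auto simp: privs_def E_def)
          then have privs_u: "card (privs (r u)) = m - e" "e \<le> m"
            using E_sub by (simp_all add: card_Diff_subset m_def e_def card_mono)
          have "u \<in> nbrs b f" using uV fV N less.prems by (auto simp: nbrs_def)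
          then have adm_f: "adm f" by (auto simp: adm_def)
          then obtain z where z: "z \<in> nbrs b f" "first_end b f = r z"
            using adm_f first_end_in[of b f] unfolding adm_def by metis
          have "z = u"
          proof (rule ccontr)
            assume "z \<noteq> u"
            then have "z \<notin> N" using z N by (auto simp: nbrs_def)
            then have "z \<in> useful a b"
              using z fV by (force simp: nbrs_def useful_def N_def privs_def)
            then show False using U0 by simp
          qed
          have "card (cands (first_end b f) (r f)) \<le> card (privs (r u))"
            using z \<open>z = u\<close> by (intro card_mono finite_sets) (auto simp: cands_def privs_def)
          then have wt_f: "wt b f \<le> wC ^ (m - e) * wD ^ m"
            using privs_u privs_le[OF fN] by (intro wt_le) auto
          have wt_u: "wt b u \<le> wC ^ m * wD ^ (m - e)" if "adm u"
            using privs_u N that end_ge[of u] cands_le by (intro wt_le) auto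
          have "(\<Sum>s | s \<in> N \<and> adm s. wt b s) \<le> wC ^ (m - e) * wD ^ m + wC ^ m * wD ^ (m - e)"
          proof (cases "adm u")
            case True
            then have "{s. s \<in> N \<and> adm s} = {f, u}" using N adm_f by auto
            then show ?thesis using wt_f wt_u True N by simp
          next
            case False
            then have "{s. s \<in> N \<and> adm s} = {f}" using N adm_f by auto
            then show ?thesis using wt_f by (simp add: add_increasing2)
          qed
          \<comment> \<open>For e = 0 this is an equality with three equal summands, as for an
            isolated edge: u reaches nothing beyond f and does not become useful. For e > 0 one loss
            in each of the first two summands makes up for u becoming useful.\<close>
          moreover have "wC ^ (m - e) * wD ^ m + wC ^ m * wD ^ (m - e) + sqrt 3 ^ m * wD ^ q' \<le> 3 * sqrt 3 ^ m"
          proof (cases "e = 0")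
            case True
            then have "E = {}" by (simp add: e_def)
            then have "useful (r f) b = {}"
              using useful_sub U0 N by (auto simp: useful_def E_def)
            then have "q' = 0" by (simp add: q'_def)
            then show ?thesis using True by (simp add: sqrt3_power_split)
          next
            case False
            have "q' \<le> 1" using q'_le True by simp
            then have "wD ^ q' \<le> wD ^ 1" by (intro power_increasing) auto
            then have 1: "sqrt 3 ^ m * wD ^ q' \<le> sqrt 3 ^ m * wD"
              by (intro mult_left_mono) auto
            have "wC ^ (m - e) \<le> wC ^ (m - 1)" "wD ^ (m - e) \<le> wD ^ (m - 1)"
              using False by (auto intro!: power_increasing)
            then have 2: "wC ^ (m - e) * wD ^ m + wC ^ m * wD ^ (m - e) \<le>
                wC ^ (m - 1) * wD ^ m + wC ^ m * wD ^ (m - 1)"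
              by (intro add_mono mult_right_mono mult_left_mono) auto
            obtain k where k: "m = Suc k" using False privs_u by (cases m) auto
            have 3: "wC ^ (m - 1) * wD ^ m + wC ^ m * wD ^ (m - 1) = sqrt 3 ^ k * (wC + wD)"
              by (simp add: k sqrt3_power_split algebra_simps)
            have "wC + wD + sqrt 3 * wD \<le> 3 * sqrt 3"
            proof -
              have "(3 - 12248/10000) * (1732/1000) \<le> (3 - wD) * sqrt 3"
                using sqrt3_bounds wD_bounds by (intro mult_mono) auto
              then show ?thesis using wC_bounds wD_bounds by (simp add: algebra_simps)
            qed
            then have "sqrt 3 ^ k * (wC + wD + sqrt 3 * wD) \<le> sqrt 3 ^ k * (3 * sqrt 3)"
              by (intro mult_left_mono) auto
            also have "\<dots> = 3 * sqrt 3 ^ m" by (simp add: k)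
            finally have "sqrt 3 ^ k * (wC + wD) + sqrt 3 ^ m * wD \<le> 3 * sqrt 3 ^ m"
              by (simp add: k distrib_left mult.assoc mult.left_commute)
            then show ?thesis using 1 2 3 by linarith
          qed
          moreover have "sqrt 3 ^ card (privs a) * wD ^ card (useful a b) = 3 * sqrt 3 ^ m"
            using True by (simp add: card_a U0 flip: mult.assoc)
          ultimately show ?thesis
            using sum_split rest by linarith
        next
          case nspecial: False
          have "(\<Sum>s | s \<in> N \<and> adm s. wt b s) \<le> (\<Sum>s | s \<in> N \<and> adm s. sqrt 3 ^ m)"
            unfolding sqrt3_power_split
            using privs_le cands_le end_ge by (intro sum_mono wt_le) auto
          also have "\<dots> \<le> (\<Sum>s\<in>N. sqrt 3 ^ m)"
            by (intro sum_mono2) auto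
          also have "\<dots> = sqrt 3 ^ m * (1 + real t)" by (simp add: t)
          finally have 1: "(\<Sum>s | s \<in> N \<and> adm s. wt b s) \<le> sqrt 3 ^ m * (1 + real t)" .
          have "wD ^ q' \<le> wD ^ (q + t)"
            using q'_le Y by (intro power_increasing) auto
          then have "sqrt 3 ^ m * wD ^ q' \<le> sqrt 3 ^ m * wD ^ (q + t)"
            by (intro mult_left_mono) auto
          then have "(\<Sum>s | s \<in> privs a \<and> nbrs b s \<noteq> {}. wt b s) \<le>
              sqrt 3 ^ m * (1 + real t) + sqrt 3 ^ m * wD ^ (q + t)"
            using 1 sum_split rest by linarith
          also have "\<dots> = sqrt 3 ^ m * (1 + real t + wD ^ (q + t))"
            by (simp add: algebra_simps)
          also have "\<dots> \<le> sqrt 3 ^ m * (sqrt 3 ^ Suc t * wD ^ q)"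
            using False nspecial by (intro mult_left_mono clique_ineq) auto
          also have "\<dots> = sqrt 3 ^ card (privs a) * wD ^ q"
            unfolding card_a by (simp add: power_add ac_simps)
          finally show ?thesis by (simp add: q_def)
        qed
      next
        case Y: False
        have "card Y \<noteq> 0" using Y Y_sub by (metis card_0_eq finite_sets(4) finite_subset)
        moreover have "card Y \<le> q" unfolding q_def using Y_sub by (intro card_mono) auto
        ultimately obtain p where p: "q = Suc p" "q' \<le> p + t"
          using q'_le by (cases q) auto
        \<comment> \<open>Now a private neighbour may end before f, and later members of N can
          remain candidates. Only those that begin no later than s are surely excluded, so the
          exponent depends on the rank of s by left ends.\<close>
        have "(\<Sum>s | s \<in> N \<and> adm s. wt b s) \<le>
            (\<Sum>s | s \<in> N \<and> adm s. wC ^ (m + Suc t - card {v\<in>N. l v \<le> l s}) * wD ^ m)"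
        proof (intro sum_mono wt_le)
          fix s assume s: "s \<in> {s. s \<in> N \<and> adm s}"
          then have "l s \<le> first_end b s" using l_le_first_end by (auto simp: adm_def)
          then have "cands (first_end b s) (r s) \<subseteq> privs a - {v\<in>N. l v \<le> l s}"
            using s by (auto simp: cands_def privs_def N_def)
          then have "card (cands (first_end b s) (r s)) \<le> card (privs a - {v\<in>N. l v \<le> l s})"
            by (intro card_mono) auto
          also have "\<dots> = card (privs a) - card {v\<in>N. l v \<le> l s}"
            by (intro card_Diff_subset) (auto simp: N_def)
          finally show "card (cands (first_end b s) (r s)) \<le> m + Suc t - card {v\<in>N. l v \<le> l s}"
            using card_a by simp
        qed (use privs_le in auto)
        also have "\<dots> \<le> (\<Sum>s\<in>N. wC ^ (m + Suc t - card {v\<in>N. l v \<le> l s}) * wD ^ m)"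
          by (intro sum_mono2) auto
        also have "\<dots> \<le> wC ^ m * (\<Sum>k\<le>t. wC ^ k) * wD ^ m"
          unfolding sum_distrib_right [symmetric]
          by (intro mult_right_mono sum_wC_rank_le t) auto
        finally have 1: "(\<Sum>s | s \<in> N \<and> adm s. wt b s) \<le> sqrt 3 ^ m * (\<Sum>k\<le>t. wC ^ k)"
          by (simp add: sqrt3_power_split ac_simps)
        also have "\<dots> \<le> sqrt 3 ^ m * ((\<Sum>k\<le>t. wC ^ k) * wD ^ p)"
          using mult_left_mono[OF wD_power_ge1[of p], of "\<Sum>k\<le>t. wC ^ k"]
          by (intro mult_left_mono) (auto simp: sum_nonneg)
        finally have 1: "(\<Sum>s | s \<in> N \<and> adm s. wt b s) \<le> sqrt 3 ^ m * ((\<Sum>k\<le>t. wC ^ k) * wD ^ p)" .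
        have "wD ^ q' \<le> wD ^ (p + t)"
          using p by (intro power_increasing) auto
        then have 2: "sqrt 3 ^ m * wD ^ q' \<le> sqrt 3 ^ m * (wD ^ t * wD ^ p)"
          by (intro mult_left_mono) (auto simp: power_add ac_simps)
        have "((\<Sum>k\<le>t. wC ^ k) + wD ^ t) * wD ^ p \<le> wC ^ Suc t * wD ^ (t + 2) * wD ^ p"
          using False by (intro mult_right_mono staircase_ineq) auto
        then have 3: "sqrt 3 ^ m * (((\<Sum>k\<le>t. wC ^ k) + wD ^ t) * wD ^ p) \<le>
            sqrt 3 ^ m * (wC ^ Suc t * wD ^ (t + 2) * wD ^ p)"
          by (intro mult_left_mono) auto
        have "(\<Sum>s | s \<in> privs a \<and> nbrs b s \<noteq> {}. wt b s) \<le>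
            sqrt 3 ^ m * ((\<Sum>k\<le>t. wC ^ k) * wD ^ p) + sqrt 3 ^ m * (wD ^ t * wD ^ p)"
          using 1 2 sum_split rest by linarith
        also have "\<dots> = sqrt 3 ^ m * (((\<Sum>k\<le>t. wC ^ k) + wD ^ t) * wD ^ p)"
          by (simp only: distrib_left distrib_right)
        also note 3
        also have "sqrt 3 ^ m * (wC ^ Suc t * wD ^ (t + 2) * wD ^ p) = sqrt 3 ^ card (privs a) * wD ^ q"
          unfolding sqrt3_power_split card_a p by (simp add: power_add ac_simps)
        finally show ?thesis by (simp add: q_def)
      qed
    qed
  qed
qed

section \<open>The branching inequality for arbitrary thresholds\<close>

lemma obtain_card_first:
  assumes "f \<in> privs b"
  defines "N \<equiv> {v\<in>privs b. l v \<le> r f}"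
  obtains t where "card N = Suc t" "card (privs b) = Suc t + card (privs (r f))"
proof -
  have f: "f \<in> V" "b < l f" "l f \<le> r f"
    using assms l_le_r by (auto simp: privs_def)
  have "finite N" "f \<in> N" using f assms by (auto simp: N_def)
  then obtain t where t: "card N = Suc t"
    by (metis card_0_eq empty_iff not0_implies_Suc)
  moreover have "privs b = N \<union> privs (r f)" "N \<inter> privs (r f) = {}"
    using f by (auto simp: N_def privs_def)
  then have "card (privs b) = Suc t + card (privs (r f))"
    using t \<open>finite N\<close> by (simp add: card_Un_disjoint)
  ultimately show ?thesis by (rule that)
qed

text \<open>For b \<le> a, useful intervals and candidates are disjoint parts of
  \<open>privs b\<close>, so the slack factor of \<open>weighted_sum_le\<close> is already contained
  in the weight. For a < b, the candidates containing b are summed separately: their number enters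
  linearly, against a factor \<open>wC\<close> for each of them.\<close>

lemma branching_le:
  "(\<Sum>s | s \<in> cands a b \<and> nbrs b s \<noteq> {}. wt b s) \<le> wC ^ card (cands a b) * wD ^ card (privs b)"
proof (cases "b \<le> a")
  case True
  have "a < l v \<Longrightarrow> v \<in> V \<Longrightarrow> b < r v" for v using l_le_r[of v] True by auto
  then have cands: "cands a b = privs a" by (auto simp: cands_def privs_def)
  have "privs a \<union> useful a b \<subseteq> privs b" "privs a \<inter> useful a b = {}"
    using True by (auto simp: privs_def useful_def)
  then have "card (privs a) + card (useful a b) \<le> card (privs b)"
    by (metis card_Un_disjoint card_mono finite_sets(2) finite_sets(4))
  then have "wC ^ card (privs a) * wD ^ (card (privs a) + card (useful a b)) \<le>
      wC ^ card (privs a) * wD ^ card (privs b)"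
    by (intro mult_left_mono power_increasing) auto
  moreover have "(\<Sum>s | s \<in> privs a \<and> nbrs b s \<noteq> {}. wt b s) \<le>
      wC ^ card (privs a) * wD ^ (card (privs a) + card (useful a b))"
    using weighted_sum_le[OF True] unfolding sqrt3_power_split by (simp add: power_add mult.assoc)
  ultimately show ?thesis unfolding cands by linarith
next
  case False
  \<comment> \<open>these contain \<open>b\<close>, hence they can be members of the set, but not private neighbours\<close>
  define X where "X = {v\<in>V. a < l v \<and> l v \<le> b \<and> b < r v}"
  have [simp]: "finite X" using finite_V by (simp add: X_def)
  have "b < l v \<Longrightarrow> v \<in> V \<Longrightarrow> b < r v" for v using l_le_r[of v] by auto
  then have cands: "cands a b = X \<union> privs b" "X \<inter> privs b = {}"
    using False by (auto simp: cands_def privs_def X_def)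
  then have card_C: "card (cands a b) = card X + card (privs b)"
    by (simp add: card_Un_disjoint)
  show ?thesis
  proof (cases "privs b = {}")
    case True
    then have "nbrs b s = {}" for s by (auto simp: nbrs_def privs_def)
    then show ?thesis by simp
  next
    case False
    obtain f where f: "f \<in> privs b" and f_min: "\<And>v. v \<in> privs b \<Longrightarrow> r f \<le> r v"
      using obtain_first[OF False] by metis
    define N where "N = {v\<in>privs b. l v \<le> r f}"
    define m where "m = card (privs (r f))"
    obtain t where t: "card N = Suc t" "card (privs b) = Suc t + m"
      using obtain_card_first[OF f] unfolding N_def m_def by metis
    have fV: "f \<in> V" "b < l f" "l f \<le> r f" using f l_le_r by (auto simp: privs_def)
    \<comment> \<open>Every possible private neighbour of s ends no earlier than f, so X and N both
      drop out of the candidates. The neighbour p begins by the end of s and drops out of the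
      private ones.\<close>
    have wt_X: "wt b s \<le> wC ^ m * wD ^ (t + m)" if s: "s \<in> X" "nbrs b s \<noteq> {}" for s
    proof (rule wt_le)
      obtain p where p: "p \<in> nbrs b s" "first_end b s = r p"
        using s first_end_in[of b s] by metis
      then have pb: "p \<in> privs b" by (auto simp: nbrs_def privs_def)
      then have "r f \<le> first_end b s" using p f_min by simp
      then have "cands (first_end b s) (r s) \<subseteq> privs (r f)"
        by (auto simp: cands_def privs_def)
      then show "card (cands (first_end b s) (r s)) \<le> m" by (simp add: m_def card_mono)
      have "privs (r s) \<subseteq> privs b - {p}"
        using s p by (auto simp: privs_def nbrs_def X_def)
      then have "card (privs (r s)) \<le> card (privs b - {p})" by (intro card_mono) auto
      then show "card (privs (r s)) \<le> t + m" using pb t by simp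
    qed
    have "(\<Sum>s | s \<in> X \<and> nbrs b s \<noteq> {}. wt b s) \<le> (\<Sum>s | s \<in> X \<and> nbrs b s \<noteq> {}. wC ^ m * wD ^ (t + m))"
      using wt_X by (intro sum_mono) auto
    also have "\<dots> \<le> (\<Sum>s\<in>X. wC ^ m * wD ^ (t + m))"
      by (intro sum_mono2) auto
    also have "\<dots> = sqrt 3 ^ m * (real (card X) * wD ^ t)"
      by (simp add: sqrt3_power_split power_add)
    finally have sum_X: "(\<Sum>s | s \<in> X \<and> nbrs b s \<noteq> {}. wt b s) \<le> sqrt 3 ^ m * (real (card X) * wD ^ t)" .
    have sum_split: "(\<Sum>s | s \<in> cands a b \<and> nbrs b s \<noteq> {}. wt b s) =
        (\<Sum>s | s \<in> X \<and> nbrs b s \<noteq> {}. wt b s) + (\<Sum>s | s \<in> privs b \<and> nbrs b s \<noteq> {}. wt b s)"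
      using cands by (subst sum.union_disjoint [symmetric]) (auto intro!: sum.cong)
    have rhs: "wC ^ card (cands a b) * wD ^ card (privs b) = sqrt 3 ^ m * (sqrt 3 ^ Suc t * wC ^ card X)"
      unfolding card_C t sqrt3_power_split by (simp add: power_add ac_simps)
    have "useful b b = {}" by (auto simp: useful_def)
    then have sum_D: "(\<Sum>s | s \<in> privs b \<and> nbrs b s \<noteq> {}. wt b s) \<le> sqrt 3 ^ m * sqrt 3 ^ Suc t"
      using weighted_sum_le[of b b] t by (simp add: power_add ac_simps)
    show ?thesis
    proof (cases "t = 0")
      case True
      have "f \<in> N" using f fV by (simp add: N_def)
      then have N: "N = {f}" using t True by (metis One_nat_def card_1_singletonE singletonD)
      \<comment> \<open>Members of X may meet f, but they begin too early to be private. So f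
        contributes nothing, and the sum over the rest is better than the general bound by a factor
        \<open>sqrt 3\<close>.\<close>
      have f_isolated: "nbrs b f = {}"
        using N by (force simp: nbrs_def N_def privs_def)
      have "{s. s \<in> privs b \<and> nbrs b s \<noteq> {}} = {s. s \<in> privs (r f) \<and> nbrs b s \<noteq> {}}"
        using N f_isolated fV by (force simp: N_def privs_def)
      moreover have "useful (r f) b = {}"
        using N by (force simp: useful_def N_def privs_def)
      ultimately have sum_D: "(\<Sum>s | s \<in> privs b \<and> nbrs b s \<noteq> {}. wt b s) \<le> sqrt 3 ^ m"
        using weighted_sum_le[of b "r f"] fV by (simp add: m_def)
      have "sqrt 3 ^ m * (1 + real (card X)) \<le> sqrt 3 ^ m * (sqrt 3 * wC ^ card X)"
        by (intro mult_left_mono linear_le_wC_power) auto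
      then have "sqrt 3 ^ m * real (card X) + sqrt 3 ^ m \<le> sqrt 3 ^ m * (sqrt 3 * wC ^ card X)"
        by (simp only: distrib_left mult_1_right add.commute)
      then show ?thesis
        using sum_X sum_D unfolding sum_split rhs by (simp add: True)
    next
      case False
      then obtain k where k: "t = Suc k" by (cases t) auto
      have "wC * wD ^ t \<le> sqrt 3 ^ t"
      proof -
        have "wC * wD ^ t * 1 \<le> wC * wD ^ t * wC ^ k"
          using wC_power_ge1 by (intro mult_left_mono) auto
        also have "wC * wD ^ t * wC ^ k = sqrt 3 ^ t"
          unfolding sqrt3_power_split k by simp
        finally show ?thesis by simp
      qed
      \<comment> \<open>Multiplication by \<open>wC * sqrt 3\<close> lets the estimate of
        \<open>wC * wD ^ t\<close>, valid as t \<ge> 1, produce the form of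
        \<open>crossing_le_wC_power\<close>.\<close>
      have "wC * sqrt 3 * (real (card X) * wD ^ t) = sqrt 3 * real (card X) * (wC * wD ^ t)"
        by simp
      also have "\<dots> \<le> sqrt 3 * real (card X) * sqrt 3 ^ t"
        using \<open>wC * wD ^ t \<le> sqrt 3 ^ t\<close> by (intro mult_left_mono) auto
      also have "\<dots> = sqrt 3 ^ Suc t * real (card X)" by simp
      finally have "wC * sqrt 3 * (real (card X) * wD ^ t) + wC * sqrt 3 * sqrt 3 ^ Suc t \<le>
          sqrt 3 ^ Suc t * (wC * sqrt 3 + real (card X))"
        by (simp add: algebra_simps)
      also have "\<dots> \<le> sqrt 3 ^ Suc t * (wC * sqrt 3 * wC ^ card X)"
        by (intro mult_left_mono crossing_le_wC_power) auto
      finally have "(wC * sqrt 3) * (real (card X) * wD ^ t + sqrt 3 ^ Suc t) \<le>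
          (wC * sqrt 3) * (sqrt 3 ^ Suc t * wC ^ card X)"
        by (simp only: distrib_left ac_simps)
      then have "real (card X) * wD ^ t + sqrt 3 ^ Suc t \<le> sqrt 3 ^ Suc t * wC ^ card X"
        by (rule mult_left_le_imp_le) auto
      then have "sqrt 3 ^ m * (real (card X) * wD ^ t + sqrt 3 ^ Suc t) \<le>
          sqrt 3 ^ m * (sqrt 3 ^ Suc t * wC ^ card X)"
        by (intro mult_left_mono) auto
      moreover have "sqrt 3 ^ m * (real (card X) * wD ^ t + sqrt 3 ^ Suc t) =
          sqrt 3 ^ m * (real (card X) * wD ^ t) + sqrt 3 ^ m * sqrt 3 ^ Suc t"
        by (rule distrib_left)
      ultimately show ?thesis
        using sum_X sum_D unfolding sum_split rhs by linarith
    qed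
  qed
qed

section \<open>From branching to the number of open irredundant sets\<close>

definition adjacent :: "'a \<Rightarrow> 'a \<Rightarrow> bool" where
  "adjacent u v \<longleftrightarrow> u \<noteq> v \<and> l u \<le> r v \<and> l v \<le> r u"

definition irredundant :: "real \<Rightarrow> real \<Rightarrow> 'a set set" where
  "irredundant a b = {S. S \<subseteq> cands a b \<and>
     (\<forall>s\<in>S. \<exists>p\<in>privs b. p \<notin> S \<and> adjacent s p \<and> (\<forall>t\<in>S. t \<noteq> s \<longrightarrow> \<not> adjacent t p))}"

lemma finite_irredundant [simp]: "finite (irredundant a b)"
  by (rule finite_subset[of _ "Pow (cands a b)"]) (auto simp: irredundant_def)

text \<open>Let s be a member that ends first. Another member ends no earlier than s, hence not
  before p begins; to miss p it must begin after p ends. A private neighbour of another member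
  misses s but ends after s begins, so it begins after s ends.\<close>

lemma irredundant_split:
  assumes S: "S \<in> irredundant a b" "S \<noteq> {}"
  obtains s where "s \<in> S" "s \<in> cands a b" "nbrs b s \<noteq> {}"
    "S - {s} \<in> irredundant (first_end b s) (r s)"
proof -
  have "finite S" using S finite_sets(1) by (auto simp: irredundant_def intro: finite_subset)
  then have "Min (r ` S) \<in> r ` S" using S by (intro Min_in) auto
  then obtain s where "s \<in> S" "r s = Min (r ` S)" by force
  then have s: "s \<in> S" and s_min: "\<And>t. t \<in> S \<Longrightarrow> r s \<le> r t"
    using \<open>finite S\<close> by auto
  have SC: "t \<in> V" "a < l t" "b < r t" if "t \<in> S" for t
    using that S by (auto simp: irredundant_def cands_def)
  obtain p where p: "p \<in> privs b" "p \<notin> S" "adjacent s p" "\<And>t. t \<in> S \<Longrightarrow> t \<noteq> s \<Longrightarrow> \<not> adjacent t p"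
    using S s unfolding irredundant_def by blast
  have pn: "p \<in> nbrs b s" using p by (auto simp: nbrs_def privs_def adjacent_def)
  have past: "first_end b s < l t" if t: "t \<in> S" "t \<noteq> s" for t
  proof -
    have "\<not> adjacent t p" "t \<noteq> p" using p t by auto
    then have "r p < l t"
      using s_min[OF t(1)] p(3) by (auto simp: adjacent_def)
    then show ?thesis using first_end_le[OF pn] by simp
  qed
  have "S - {s} \<in> irredundant (first_end b s) (r s)"
    unfolding irredundant_def
  proof (intro CollectI conjI ballI subsetI)
    fix t assume t: "t \<in> S - {s}"
    then obtain w where w: "w \<in> privs b" "w \<notin> S" "adjacent t w"
      "\<And>u. u \<in> S \<Longrightarrow> u \<noteq> t \<Longrightarrow> \<not> adjacent u w"
      using S unfolding irredundant_def by blast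
    have lt: "l s < l t"
      using l_le_first_end[of b s] pn past[of t] t by force
    have "\<not> adjacent s w" "s \<noteq> w" using w s t by auto
    then have "r s < l w"
      using w(3) lt by (auto simp: adjacent_def)
    moreover from this have "r s < r t" using w(3) by (auto simp: adjacent_def)
    ultimately show "t \<in> cands (first_end b s) (r s)"
      and "\<exists>p\<in>privs (r s). p \<notin> S - {s} \<and> adjacent t p \<and> (\<forall>u\<in>S - {s}. u \<noteq> t \<longrightarrow> \<not> adjacent u p)"
      using past t SC w by (auto simp: cands_def privs_def)
  qed
  moreover have "s \<in> cands a b" using SC s by (auto simp: cands_def)
  ultimately show ?thesis using that s pn by blast
qed

text \<open>By \<open>branching_le\<close> the total weight does not grow from one level of the
  branching to the next. Each level adds 1 for the empty set at most once per unit of weight, and s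
  leaves the candidates, which limits the depth; this is the linear factor.\<close>

lemma card_irredundant_le:
  "real (card (irredundant a b)) \<le> (card (cands a b) + 1) * (wC ^ card (cands a b) * wD ^ card (privs b))"
proof (induction "card (cands a b)" arbitrary: a b rule: less_induct)
  case less
  let ?K = "{s. s \<in> cands a b \<and> nbrs b s \<noteq> {}}"
  have fin: "finite ?K" by (rule finite_subset[of _ "cands a b"]) auto
  have step: "real (card (irredundant (first_end b s) (r s))) \<le> card (cands a b) * wt b s" if "s \<in> ?K" for s
  proof -
    have "a < first_end b s" using that l_le_first_end[of b s] by (auto simp: cands_def)
    then have "cands (first_end b s) (r s) \<subseteq> cands a b"
      using that by (auto simp: cands_def)
    moreover have "s \<in> cands a b - cands (first_end b s) (r s)"
      using that by (auto simp: cands_def)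
    ultimately have "cands (first_end b s) (r s) \<subset> cands a b" by blast
    then have lt: "card (cands (first_end b s) (r s)) < card (cands a b)"
      by (intro psubset_card_mono) auto
    then have "real (card (irredundant (first_end b s) (r s))) \<le>
        (card (cands (first_end b s) (r s)) + 1) * wt b s"
      using less unfolding wt_def by simp
    also have "\<dots> \<le> card (cands a b) * wt b s"
      using lt by (intro mult_right_mono) auto
    finally show ?thesis .
  qed
  have "irredundant a b \<subseteq> insert {} (\<Union>s\<in>?K. insert s ` irredundant (first_end b s) (r s))"
  proof
    fix S assume S: "S \<in> irredundant a b"
    show "S \<in> insert {} (\<Union>s\<in>?K. insert s ` irredundant (first_end b s) (r s))"
    proof (cases "S = {}")
      case False
      then obtain s where "s \<in> S" "s \<in> cands a b" "nbrs b s \<noteq> {}"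
          "S - {s} \<in> irredundant (first_end b s) (r s)"
        using irredundant_split S by metis
      then have "s \<in> ?K" "S \<in> insert s ` irredundant (first_end b s) (r s)"
        by (auto intro!: image_eqI[of _ _ "S - {s}"])
      then show ?thesis by blast
    qed simp
  qed
  then have "card (irredundant a b) \<le>
      card (insert {} (\<Union>s\<in>?K. insert s ` irredundant (first_end b s) (r s)))"
    using fin by (intro card_mono) auto
  also have "\<dots> \<le> Suc (card (\<Union>s\<in>?K. insert s ` irredundant (first_end b s) (r s)))"
    by (rule card_insert_le_m1) auto
  also have "\<dots> \<le> Suc (\<Sum>s\<in>?K. card (insert s ` irredundant (first_end b s) (r s)))"
    using fin by (intro Suc_le_mono[THEN iffD2] card_UN_le) auto
  also have "\<dots> \<le> Suc (\<Sum>s\<in>?K. card (irredundant (first_end b s) (r s)))"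
    by (intro Suc_le_mono[THEN iffD2] sum_mono card_image_le) auto
  finally have "real (card (irredundant a b)) \<le> real (Suc (\<Sum>s\<in>?K. card (irredundant (first_end b s) (r s))))"
    by (rule of_nat_mono)
  also have "\<dots> = 1 + (\<Sum>s\<in>?K. real (card (irredundant (first_end b s) (r s))))"
    by simp
  also have "\<dots> \<le> 1 + (\<Sum>s\<in>?K. card (cands a b) * wt b s)"
    using step by (intro add_left_mono sum_mono) auto
  also have "\<dots> = 1 + card (cands a b) * (\<Sum>s\<in>?K. wt b s)"
    by (simp add: sum_distrib_left)
  also have "\<dots> \<le> 1 * (wC ^ card (cands a b) * wD ^ card (privs b)) +
      card (cands a b) * (wC ^ card (cands a b) * wD ^ card (privs b))"
  proof (intro add_mono mult_left_mono branching_le)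
    have "1 * 1 \<le> wC ^ card (cands a b) * wD ^ card (privs b)"
      using wC_power_ge1 wD_power_ge1 by (intro mult_mono) auto
    then show "1 \<le> 1 * (wC ^ card (cands a b) * wD ^ card (privs b))" by simp
  qed auto
  finally show ?case by (simp add: algebra_simps)
qed

lemma card_open_irredundant_le:
  "real (card {S. S \<subseteq> V \<and> (\<forall>s\<in>S. \<exists>p\<in>V. p \<notin> S \<and> adjacent s p \<and> (\<forall>t\<in>S. t \<noteq> s \<longrightarrow> \<not> adjacent t p))})
    \<le> (card V + 1) * sqrt 3 ^ card V"
proof -
  \<comment> \<open>Left of all intervals, so both thresholds are initially without effect. The
    inserted 0 keeps the minimum meaningful for empty V.\<close>
  define a where "a = Min (insert 0 (l ` V)) - 1"
  have "a < l v" if "v \<in> V" for v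
  proof -
    have "Min (insert 0 (l ` V)) \<le> l v" using that finite_V by (intro Min_le) auto
    then show ?thesis by (simp add: a_def)
  qed
  moreover from this have "a < r v" if "v \<in> V" for v
    using that l_le_r by (meson less_le_trans)
  ultimately have "cands a a = V" "privs a = V" by (auto simp: cands_def privs_def)
  then show ?thesis
    using card_irredundant_le[of a a] by (simp add: irredundant_def sqrt3_power_split)
qed

end

section \<open>Reasoning about programs\<close>

definition vars :: "string set" where
  "vars = {''n'', ''adj'', ''row'', ''S'', ''f'', ''stk'', ''sz'', ''j'', ''v'', ''p'', ''u'', ''bad'', ''found'', ''hit''}"

text \<open>One bound for addresses and contents; as \<open>vars\<close> is finite, this invariant
  alone limits the space.\<close>

definition bounded_mem :: "nat \<Rightarrow> mem \<Rightarrow> bool" where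
  "bounded_mem N s \<longleftrightarrow> (\<forall>x i. s x i \<noteq> 0 \<longrightarrow> x \<in> vars \<and> i \<le> N \<and> s x i \<le> N)"

definition outs :: "config \<Rightarrow> nat \<Rightarrow> nat list list" where
  "outs k t = List.map_filter (\<lambda>u. emitted ((step ^^ u) k)) [0..<t]"

text \<open>The last configuration is exempt from the conditions, so that traces compose and may end
  in the halted configuration.\<close>

definition trace :: "nat \<Rightarrow> config \<Rightarrow> nat \<Rightarrow> config \<Rightarrow> nat list list \<Rightarrow> bool" where
  "trace N k t k' L \<longleftrightarrow> (step ^^ t) k = k' \<and> outs k t = L \<and>
     (\<forall>u<t. fst ((step ^^ u) k) \<noteq> [] \<and> bounded_mem N (snd ((step ^^ u) k)))"

text \<open>
  Total correctness with a bound on the number of steps; \<open>Q\<close> relates the solutions that are output to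
  the final memory.
\<close>

definition exec :: "nat \<Rightarrow> nat \<Rightarrow> com \<Rightarrow> mem \<Rightarrow> (nat list list \<Rightarrow> mem \<Rightarrow> bool) \<Rightarrow> bool" where
  "exec N \<tau> c s Q \<longleftrightarrow> (bounded_mem N s \<longrightarrow>
     (\<exists>t L s'. t \<le> \<tau> \<and> (\<forall>K. trace N (c # K, s) t (K, s') L) \<and> bounded_mem N s' \<and> Q L s'))"

lemma bounded_mem_le: "bounded_mem N s \<Longrightarrow> s x i \<le> N"
  by (cases "s x i = 0") (auto simp: bounded_mem_def)

lemma bounded_mem_update:
  assumes "bounded_mem N s" "x \<in> vars" "i \<le> N" "a \<le> N"
  shows "bounded_mem N (s(x := (s x)(i := a)))"
  using assms by (auto simp: bounded_mem_def)

lemma step_add: "(step ^^ (t + u)) k = (step ^^ u) ((step ^^ t) k)"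
  by (subst add.commute) (simp add: funpow_add)

lemma outs_0 [simp]: "outs k 0 = []"
  by (simp add: outs_def List.map_filter_def)

lemma outs_add: "outs k (t + u) = outs k t @ outs ((step ^^ t) k) u"
proof -
  have shift: "[t..<t + u] = map (\<lambda>v. t + v) [0..<u]"
    by (induction u) auto
  have "[0..<t + u] = [0..<t] @ map (\<lambda>v. t + v) [0..<u]"
    unfolding shift [symmetric] by (rule upt_add_eq_append) simp
  then show ?thesis
    by (simp add: outs_def step_add List.map_filter_def filter_map o_def)
qed

lemma outs_1 [simp]: "outs k (Suc 0) = (case emitted k of None \<Rightarrow> [] | Some l \<Rightarrow> [l])"
  by (auto simp: outs_def List.map_filter_def split: option.split)

lemma outs_eq_Nil: "outs k t = [] \<longleftrightarrow> (\<forall>u<t. emitted ((step ^^ u) k) = None)"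
  by (auto simp: outs_def List.map_filter_def filter_empty_conv)

lemma trace_0: "trace N k 0 k []"
  by (simp add: trace_def)

lemma trace_trans:
  assumes "trace N k t k' L" "trace N k' u k'' M"
  shows "trace N k (t + u) k'' (L @ M)"
proof -
  have "fst ((step ^^ v) k) \<noteq> [] \<and> bounded_mem N (snd ((step ^^ v) k))" if "v < t + u" for v
  proof (cases "v < t")
    case False
    then obtain w where "v = t + w" by (metis le_iff_add not_less)
    then show ?thesis using assms that by (simp add: trace_def step_add)
  qed (use assms in \<open>simp add: trace_def\<close>)
  then show ?thesis using assms by (simp add: trace_def step_add outs_add)
qed

lemma trace_step:
  assumes "fst k \<noteq> []" "bounded_mem N (snd k)" "step k = k'" "(case emitted k of None \<Rightarrow> [] | Some l \<Rightarrow> [l]) = L"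
  shows "trace N k 1 k' L"
  using assms by (auto simp: trace_def)

lemma trace_Cons:
  assumes "c # K \<noteq> []" "bounded_mem N s" "step (c # K, s) = k'" "emitted (c # K, s) = None" "trace N k' t k'' L"
  shows "trace N (c # K, s) (Suc t) k'' L"
proof -
  have "trace N (c # K, s) 1 k' []"
    by (rule trace_step) (use assms in auto)
  from trace_trans[OF this assms(5)] show ?thesis by simp
qed

lemma exec_conseq:
  assumes "exec N \<tau> c s Q" "\<And>L s'. bounded_mem N s' \<Longrightarrow> Q L s' \<Longrightarrow> Q' L s'" "\<tau> \<le> \<tau>'"
  shows "exec N \<tau>' c s Q'"
  using assms unfolding exec_def by (meson le_trans)

lemma exec_bounded:
  assumes "bounded_mem N s \<Longrightarrow> exec N \<tau> c s Q"
  shows "exec N \<tau> c s Q"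
  using assms unfolding exec_def by blast

text \<open>Any bound from 1 upwards is allowed because \<open>exec_If\<close> asks for a common
  bound of both branches.\<close>

lemma exec_Assign:
  assumes "Q [] (s(x := (s x)(aval i s := aval e s)))" "x \<in> vars" "aval i s \<le> N" "aval e s \<le> N" "1 \<le> \<tau>"
  shows "exec N \<tau> (Assign x i e) s Q"
  unfolding exec_def
proof (intro impI exI conjI allI)
  assume "bounded_mem N s"
  then show "trace N (Assign x i e # K, s) 1 (K, s(x := (s x)(aval i s := aval e s))) []" for K
    by (intro trace_step) auto
qed (use assms bounded_mem_update in auto)

lemma exec_Output:
  assumes "Q [map (s x) [0..<aval e s]] s"
  shows "exec N 1 (Output x e) s Q"
  unfolding exec_def
proof (intro impI exI conjI allI)
  assume "bounded_mem N s"
  then show "trace N (Output x e # K, s) 1 (K, s) [map (s x) [0..<aval e s]]" for K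
    by (intro trace_step) auto
qed (use assms in auto)

text \<open>The specification of \<open>d\<close> is itself the postcondition of \<open>c\<close>,
  so backward application needs no intermediate assertion; what \<open>c\<close> has output is
  passed on as L.\<close>

lemma exec_Seq:
  assumes "exec N \<tau> c s (\<lambda>L s'. exec N \<sigma> d s' (\<lambda>M. Q (L @ M)))"
  shows "exec N (\<tau> + \<sigma> + 1) (Seq c d) s Q"
proof -
  have "\<exists>t L s'. t \<le> \<tau> + \<sigma> + 1 \<and> (\<forall>K. trace N (Seq c d # K, s) t (K, s') L) \<and> bounded_mem N s' \<and> Q L s'"
    if s: "bounded_mem N s"
  proof -
    obtain t L s' where 1: "t \<le> \<tau>" "\<And>K. trace N (c # K, s) t (K, s') L" "bounded_mem N s'"
      "exec N \<sigma> d s' (\<lambda>M. Q (L @ M))"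
      using assms s unfolding exec_def[of N \<tau>] by blast
    then obtain u M s'' where 2: "u \<le> \<sigma>" "\<And>K. trace N (d # K, s') u (K, s'') M" "bounded_mem N s''" "Q (L @ M) s''"
      unfolding exec_def by blast
    have "trace N (Seq c d # K, s) (Suc (t + u)) (K, s'') (L @ M)" for K
      using s by (intro trace_Cons[OF _ _ _ _ trace_trans[OF 1(2) 2(2)]]) auto
    moreover have "Suc (t + u) \<le> \<tau> + \<sigma> + 1" using 1 2 by simp
    ultimately show ?thesis using 2 by blast
  qed
  then show ?thesis unfolding exec_def by blast
qed

lemma exec_If:
  assumes "bval b s \<Longrightarrow> exec N \<tau> c s Q" "\<not> bval b s \<Longrightarrow> exec N \<tau> d s Q"
  shows "exec N (\<tau> + 1) (If b c d) s Q"
proof -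
  have "\<exists>t L s'. t \<le> \<tau> + 1 \<and> (\<forall>K. trace N (If b c d # K, s) t (K, s') L) \<and> bounded_mem N s' \<and> Q L s'"
    if s: "bounded_mem N s"
  proof -
    have "exec N \<tau> (if bval b s then c else d) s Q" using assms by simp
    then obtain t L s' where 1: "t \<le> \<tau>" "\<And>K. trace N ((if bval b s then c else d) # K, s) t (K, s') L"
      "bounded_mem N s'" "Q L s'"
      using s unfolding exec_def by blast
    have "trace N (If b c d # K, s) (Suc t) (K, s') L" for K
      using s by (intro trace_Cons[OF _ _ _ _ 1(2)]) auto
    then show ?thesis using 1 by (metis Suc_eq_plus1 Suc_le_mono)
  qed
  then show ?thesis unfolding exec_def by blast
qed

section \<open>Counting loops and exhaustive search\<close>

abbreviation V :: "string \<Rightarrow> aexp" where "V x \<equiv> Cell x (Num 0)"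

text \<open>A self-assignment stands in for the idle command that the language lacks.\<close>

definition skip :: com where "skip = Assign ''v'' (Num 0) (V ''v'')"

lemma exec_skip: "Q [] s \<Longrightarrow> exec N 1 skip s Q"
  unfolding skip_def
  by (rule exec_bounded, rule exec_Assign) (auto simp: vars_def bounded_mem_le)

definition For :: "string \<Rightarrow> com \<Rightarrow> com" where
  "For i c = Seq (Assign i (Num 0) (Num 0))
     (While (Less (V i) (V ''n'')) (Seq c (Assign i (Num 0) (Plus (V i) (Num 1)))))"

text \<open>A round consists of the test, the unfolding of \<open>Seq\<close>, the body and the
  increment, hence \<open>\<tau> + 3\<close>. The body has to establish the invariant for the memory
  in which the counter is already increased.\<close>

lemma exec_While_count:
  assumes "\<And>k s. k < n \<Longrightarrow> s i 0 = k \<Longrightarrow> s ''n'' 0 = n \<Longrightarrow> Inv k s \<Longrightarrow>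
      exec N \<tau> c s (\<lambda>L s'. L = [] \<and> s' i 0 = k \<and> s' ''n'' 0 = n \<and> Inv (Suc k) (s'(i := (s' i)(0 := Suc k))))"
    and "i \<in> vars" "i \<noteq> ''n''" "n \<le> N"
    and "k \<le> n" "s i 0 = k" "s ''n'' 0 = n" "Inv k s"
  shows "exec N ((n - k) * (\<tau> + 3) + 1)
    (While (Less (V i) (V ''n'')) (Seq c (Assign i (Num 0) (Plus (V i) (Num 1))))) s
    (\<lambda>L s'. L = [] \<and> s' i 0 = n \<and> s' ''n'' 0 = n \<and> Inv n s')"
    (is "exec N _ ?W s ?Q")
  using assms(5-)
proof (induction "n - k" arbitrary: k s)
  case 0
  then have "k = n" by simp
  show ?case
    unfolding exec_def
  proof (intro impI exI conjI allI)
    assume "bounded_mem N s"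
    then show "trace N (?W # K, s) 1 (K, s) []" for K
      using 0 \<open>k = n\<close> by (intro trace_step) auto
  qed (use 0 \<open>k = n\<close> in auto)
next
  case (Suc d)
  then have k: "k < n" by simp
  have body: "exec N (\<tau> + 1 + 1) (Seq c (Assign i (Num 0) (Plus (V i) (Num 1)))) s
      (\<lambda>L s'. L = [] \<and> s' i 0 = Suc k \<and> s' ''n'' 0 = n \<and> Inv (Suc k) s')" (is "exec _ _ ?B _ _")
  proof (rule exec_Seq, rule exec_conseq[OF assms(1)[OF k Suc.prems(2-4)]])
    fix L :: "nat list list" and s'
    assume "L = [] \<and> s' i 0 = k \<and> s' ''n'' 0 = n \<and> Inv (Suc k) (s'(i := (s' i)(0 := Suc k)))"
    then show "exec N 1 (Assign i (Num 0) (Plus (V i) (Num 1))) s'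
        (\<lambda>M s'. L @ M = [] \<and> s' i 0 = Suc k \<and> s' ''n'' 0 = n \<and> Inv (Suc k) s')"
      using k assms(2-4) by (intro exec_Assign) auto
  qed simp
  show ?case
    unfolding exec_def
  proof (rule impI)
    assume s: "bounded_mem N s"
    obtain t s' where 1: "t \<le> \<tau> + 1 + 1" "\<And>K. trace N (?B # K, s) t (K, s') []" "bounded_mem N s'"
      "s' i 0 = Suc k" "s' ''n'' 0 = n" "Inv (Suc k) s'"
      using body s unfolding exec_def by blast
    have "exec N ((n - Suc k) * (\<tau> + 3) + 1) ?W s' ?Q"
      using Suc(2) 1 k by (intro Suc(1)) auto
    then obtain u s'' where 2: "u \<le> (n - Suc k) * (\<tau> + 3) + 1" "\<And>K. trace N (?W # K, s') u (K, s'') []"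
      "bounded_mem N s''" "?Q [] s''"
      using 1(3) unfolding exec_def by blast
    have "trace N (?W # K, s) (Suc (t + u)) (K, s'') ([] @ [])" for K
    proof (rule trace_Cons[OF _ s _ _ trace_trans[OF 1(2) 2(2)]])
      show "step (?W # K, s) = (?B # ?W # K, s)" using k Suc.prems by simp
    qed auto
    moreover have "Suc (t + u) \<le> (n - k) * (\<tau> + 3) + 1"
    proof -
      have "n - k = Suc (n - Suc k)" using k by simp
      then show ?thesis using 1(1) 2(1) by simp
    qed
    ultimately show "\<exists>t L s'. t \<le> (n - k) * (\<tau> + 3) + 1 \<and>
        (\<forall>K. trace N (?W # K, s) t (K, s') L) \<and> bounded_mem N s' \<and> ?Q L s'"
      using 2(3,4) unfolding append_Nil by blast
  qed
qed

lemma exec_For: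
  assumes "\<And>k s. k < n \<Longrightarrow> s i 0 = k \<Longrightarrow> s ''n'' 0 = n \<Longrightarrow> Inv k s \<Longrightarrow>
      exec N \<tau> c s (\<lambda>L s'. L = [] \<and> s' i 0 = k \<and> s' ''n'' 0 = n \<and> Inv (Suc k) (s'(i := (s' i)(0 := Suc k))))"
    and "i \<in> vars" "i \<noteq> ''n''" "n \<le> N" "s ''n'' 0 = n" "Inv 0 (s(i := (s i)(0 := 0)))"
    and "\<And>s'. s' ''n'' 0 = n \<Longrightarrow> Inv n s' \<Longrightarrow> Q [] s'"
  shows "exec N (n * (\<tau> + 3) + 3) (For i c) s Q"
proof -
  have "exec N (1 + (n * (\<tau> + 3) + 1) + 1) (For i c) s Q"
    unfolding For_def
  proof (intro exec_Seq exec_Assign)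
    let ?s = "s(i := (s i)(aval (Num 0) s := aval (Num 0) s))"
    have s: "?s i 0 = 0" "?s ''n'' 0 = n" using assms(3,5) by auto
    have "Inv 0 ?s" using assms(6) unfolding aval.simps .
    with s have "exec N ((n - 0) * (\<tau> + 3) + 1)
        (While (Less (V i) (V ''n'')) (Seq c (Assign i (Num 0) (Plus (V i) (Num 1))))) ?s
        (\<lambda>L s'. L = [] \<and> s' i 0 = n \<and> s' ''n'' 0 = n \<and> Inv n s')"
      using assms(1-4) by (intro exec_While_count[where Inv = Inv]) blast+
    then show "exec N (n * (\<tau> + 3) + 1)
        (While (Less (V i) (V ''n'')) (Seq c (Assign i (Num 0) (Plus (V i) (Num 1))))) ?s (\<lambda>M. Q ([] @ M))"
      by (rule exec_conseq) (use assms(7) in auto)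
  qed (use assms(2) in auto)
  then show ?thesis by (rule exec_conseq) auto
qed

text \<open>A quantifier as a program: c recomputes whatever b reads, and it may itself contain an
  \<open>Any\<close>, which gives nested quantifiers.\<close>

definition Any :: "string \<Rightarrow> string \<Rightarrow> com \<Rightarrow> bexp \<Rightarrow> com" where
  "Any r i c b = Seq (Assign r (Num 0) (Num 0)) (For i (Seq c (If b (Assign r (Num 0) (Num 1)) skip)))"

text \<open>M collects the arrays that c may change; this frame condition is what makes nested
  searches compose. From \<open>n < N\<close> it also follows that the flag value 1 is within the
  bound.\<close>

lemma exec_Any:
  assumes body: "\<And>k s'. k < n \<Longrightarrow> s' i 0 = k \<Longrightarrow> (\<forall>x. x \<notin> M \<union> {i, r} \<longrightarrow> s' x = s x) \<Longrightarrow>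
      exec N \<tau> c s' (\<lambda>L s''. L = [] \<and> (\<forall>x. x \<notin> M \<longrightarrow> s'' x = s' x) \<and> (bval b s'' \<longleftrightarrow> P k))"
    and "i \<in> vars" "r \<in> vars" "{i, r, ''n''} \<inter> M = {}" "i \<noteq> r" "i \<noteq> ''n''" "r \<noteq> ''n''" "n < N" "s ''n'' 0 = n"
  shows "exec N (n * (\<tau> + 6) + 5) (Any r i c b) s
    (\<lambda>L s'. L = [] \<and> (\<forall>x. x \<notin> M \<union> {i, r} \<longrightarrow> s' x = s x) \<and> s' r 0 = (if \<exists>k<n. P k then 1 else 0))"
proof -
  define Inv where "Inv = (\<lambda>k s'. (\<forall>x. x \<notin> M \<union> {i, r} \<longrightarrow> s' x = s x) \<and> s' r 0 = (if \<exists>j<k. P j then 1 else (0::nat)))"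
  have "exec N (1 + (n * ((\<tau> + (1 + 1) + 1) + 3) + 3) + 1) (Any r i c b) s
    (\<lambda>L s'. L = [] \<and> (\<forall>x. x \<notin> M \<union> {i, r} \<longrightarrow> s' x = s x) \<and> s' r 0 = (if \<exists>k<n. P k then 1 else 0))"
    unfolding Any_def
  proof (intro exec_Seq exec_Assign exec_For[where Inv = Inv])
    fix k s' assume k: "k < n" and s': "s' i 0 = k" "Inv k s'"
    have "exec N \<tau> c s' (\<lambda>L s''. L = [] \<and> (\<forall>x. x \<notin> M \<longrightarrow> s'' x = s' x) \<and> (bval b s'' \<longleftrightarrow> P k))"
      using body k s' by (auto simp: Inv_def)
    then show "exec N \<tau> c s' (\<lambda>L s'a. exec N (1 + 1) (If b (Assign r (Num 0) (Num 1)) skip) s'a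
        (\<lambda>(Ma :: nat list list) s'. L @ Ma = [] \<and> s' i 0 = k \<and> s' ''n'' 0 = n \<and> Inv (Suc k) (s'(i := (s' i)(0 := Suc k)))))"
    proof (rule exec_conseq)
      fix L :: "nat list list" and s'' assume "L = [] \<and> (\<forall>x. x \<notin> M \<longrightarrow> s'' x = s' x) \<and> (bval b s'' \<longleftrightarrow> P k)"
      then show "exec N (1 + 1) (If b (Assign r (Num 0) (Num 1)) skip) s''
          (\<lambda>(Ma :: nat list list) s'. L @ Ma = [] \<and> s' i 0 = k \<and> s' ''n'' 0 = n \<and> Inv (Suc k) (s'(i := (s' i)(0 := Suc k))))"
        using assms s' k
        by (intro exec_If exec_Assign exec_skip) (auto simp: Inv_def less_Suc_eq)
    qed simp
  qed (use assms in \<open>auto simp: Inv_def\<close>)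
  then show ?thesis by (rule exec_conseq) (auto simp: algebra_simps)
qed

section \<open>The enumeration program\<close>

text \<open>The array \<open>row\<close> holds the products that address the adjacency matrix, since
  the machine cannot multiply.\<close>

definition graph_loaded :: "nat \<Rightarrow> (nat \<times> nat) set \<Rightarrow> mem \<Rightarrow> bool" where
  "graph_loaded n E s \<longleftrightarrow> s ''n'' 0 = n \<and> (\<forall>i<n. s ''row'' i = i * n) \<and>
     (\<forall>i<n. \<forall>j<n. s ''adj'' (i * n + j) = (if (i, j) \<in> E then 1 else 0))"

definition stores_set :: "nat \<Rightarrow> nat set \<Rightarrow> mem \<Rightarrow> bool" where
  "stores_set n S s \<longleftrightarrow> (\<forall>v<n. s ''S'' v = (if v \<in> S then 1 else 0))"

text \<open>On a loop-free graph, \<open>u \<noteq> p\<close> for all \<open>u \<noteq> v\<close> in \<open>S\<close> means that \<open>p\<close> is not in \<open>S\<close>.\<close>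

definition open_irredundant :: "nat \<Rightarrow> (nat \<times> nat) set \<Rightarrow> nat set \<Rightarrow> bool" where
  "open_irredundant n E S \<longleftrightarrow>
     (\<forall>v\<in>S. \<exists>p<n. (v, p) \<in> E \<and> (\<forall>u\<in>S. u \<noteq> v \<longrightarrow> u \<noteq> p \<and> (p, u) \<notin> E))"

text \<open>The pointwise least Roman dominating function with value 2 exactly on S.\<close>

definition roman_of :: "nat \<Rightarrow> (nat \<times> nat) set \<Rightarrow> nat set \<Rightarrow> nat \<Rightarrow> nat" where
  "roman_of n E S v = (if v \<in> S then 2 else if \<exists>u<n. u \<in> S \<and> (v, u) \<in> E then 0 else 1)"

abbreviation Neq :: "aexp \<Rightarrow> aexp \<Rightarrow> bexp" where
  "Neq a b \<equiv> Not (And (Not (Less a b)) (Not (Less b a)))"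

abbreviation Adj :: "string \<Rightarrow> string \<Rightarrow> bexp" where
  "Adj x y \<equiv> Less (Num 0) (Cell ''adj'' (Plus (Cell ''row'' (V x)) (V y)))"

abbreviation In_S :: "string \<Rightarrow> bexp" where
  "In_S x \<equiv> Less (Num 0) (Cell ''S'' (V x))"

text \<open>The three searches follow the quantifiers of \<open>open_irredundant\<close>; the tests
  of \<open>hit\<close> and \<open>found\<close> for 0 are the negations between them. The innermost
  disjunction is written by De Morgan's law.\<close>

definition Check :: com where
  "Check = Any ''bad'' ''v''
     (Any ''found'' ''p''
       (Any ''hit'' ''u'' skip
         (And (In_S ''u'') (And (Neq (V ''u'') (V ''v'')) (Not (And (Not (Adj ''p'' ''u'')) (Neq (V ''u'') (V ''p'')))))))
       (And (Adj ''v'' ''p'') (Less (V ''hit'') (Num 1))))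
     (And (In_S ''v'') (Less (V ''found'') (Num 1)))"

definition Fill :: com where
  "Fill = For ''v'' (Seq (Any ''hit'' ''u'' skip (And (In_S ''u'') (Adj ''v'' ''u'')))
     (If (In_S ''v'') (Assign ''f'' (V ''v'') (Num 2))
       (Assign ''f'' (V ''v'') (Minus (Num 1) (V ''hit'')))))"

abbreviation any_time :: "nat \<Rightarrow> nat \<Rightarrow> nat" where
  "any_time n \<tau> \<equiv> n * (\<tau> + 6) + 5"

section \<open>Correctness of the irredundance test and of the output array\<close>

lemma stores_set_cong: "s' ''S'' = s ''S'' \<Longrightarrow> stores_set n S s' = stores_set n S s"
  by (simp add: stores_set_def)

lemma graph_loaded_cong:
  assumes "s' ''n'' = s ''n''" "s' ''row'' = s ''row''" "s' ''adj'' = s ''adj''"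
  shows "graph_loaded n E s' = graph_loaded n E s"
  using assms by (simp add: graph_loaded_def)

lemma bval_Adj:
  assumes "graph_loaded n E s" "s x 0 < n" "s y 0 < n"
  shows "bval (Adj x y) s \<longleftrightarrow> (s x 0, s y 0) \<in> E"
  using assms by (auto simp: graph_loaded_def)

lemma bval_In_S:
  assumes "stores_set n S s" "s x 0 < n"
  shows "bval (In_S x) s \<longleftrightarrow> s x 0 \<in> S"
  using assms by (auto simp: stores_set_def)

lemma bval_Neq: "bval (Neq a b) s \<longleftrightarrow> aval a s \<noteq> aval b s"
  by auto

lemma bval_less_one: "bval (Less a (Num 1)) s \<longleftrightarrow> aval a s = 0"
  by auto

lemma bval_pattern:
  "bval (And a (And b (Not (And (Not c) d)))) s \<longleftrightarrow> bval a s \<and> bval b s \<and> (bval c s \<or> \<not> bval d s)"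
  by auto

text \<open>The searches are verified from the inside out, each for an arbitrary memory, because the
  inner ones read the current vertices of the outer ones from memory.\<close>

lemma exec_Check:
  assumes "graph_loaded n E s" "stores_set n S s" "S \<subseteq> {..<n}" "n < N"
  shows "exec N (any_time n (any_time n (any_time n 1))) Check s
    (\<lambda>L s'. L = [] \<and> (\<forall>x. x \<notin> {''bad'', ''v'', ''found'', ''p'', ''hit'', ''u''} \<longrightarrow> s' x = s x) \<and>
      (s' ''bad'' 0 = 0 \<longleftrightarrow> open_irredundant n E S))"
proof -
  have n: "s ''n'' 0 = n" using assms by (simp add: graph_loaded_def)
  define hitting where "hitting = (\<lambda>v p u. u \<in> S \<and> u \<noteq> v \<and> ((p, u) \<in> E \<or> u = p))"
  define priv where "priv = (\<lambda>v p. (v, p) \<in> E \<and> \<not> (\<exists>u<n. hitting v p u))"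
  have hit: "exec N (any_time n 1)
      (Any ''hit'' ''u'' skip
         (And (In_S ''u'') (And (Neq (V ''u'') (V ''v'')) (Not (And (Not (Adj ''p'' ''u'')) (Neq (V ''u'') (V ''p'')))))))
      s1 (\<lambda>L s'. L = [] \<and> (\<forall>x. x \<notin> {} \<union> {''u'', ''hit''} \<longrightarrow> s' x = s1 x) \<and>
        s' ''hit'' 0 = (if \<exists>u<n. hitting (s1 ''v'' 0) (s1 ''p'' 0) u then 1 else 0))"
    if s1: "graph_loaded n E s1" "stores_set n S s1" "s1 ''p'' 0 < n" for s1
  proof (rule exec_Any)
    fix k s' assume s': "k < n" "s' ''u'' 0 = k" "\<forall>x. x \<notin> {} \<union> {''u'', ''hit''} \<longrightarrow> s' x = s1 x"
    then have inv: "graph_loaded n E s'" "stores_set n S s'" "s' ''p'' 0 = s1 ''p'' 0" "s' ''v'' 0 = s1 ''v'' 0"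
      using s1 graph_loaded_cong[of s' s1] stores_set_cong[of s' s1] by auto
    have "bval (Adj ''p'' ''u'') s' \<longleftrightarrow> (s1 ''p'' 0, k) \<in> E"
      using bval_Adj[OF inv(1), of "''p''" "''u''"] inv(3) s'(1,2) s1(3) by metis
    moreover have "bval (In_S ''u'') s' \<longleftrightarrow> k \<in> S"
      using bval_In_S[OF inv(2), of "''u''"] s'(1,2) by metis
    ultimately have "bval (And (In_S ''u'') (And (Neq (V ''u'') (V ''v'')) (Not (And (Not (Adj ''p'' ''u'')) (Neq (V ''u'') (V ''p'')))))) s' \<longleftrightarrow>
          hitting (s1 ''v'' 0) (s1 ''p'' 0) k"
      unfolding bval_pattern bval_Neq aval.simps inv(3,4) s'(2) hitting_def by blast
    then show "exec N 1 skip s' (\<lambda>L s''. L = [] \<and> (\<forall>x. x \<notin> {} \<longrightarrow> s'' x = s' x) \<and>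
        (bval (And (In_S ''u'') (And (Neq (V ''u'') (V ''v'')) (Not (And (Not (Adj ''p'' ''u'')) (Neq (V ''u'') (V ''p'')))))) s'' \<longleftrightarrow>
          hitting (s1 ''v'' 0) (s1 ''p'' 0) k))"
      by (intro exec_skip) blast
  qed (use assms(4) s1(1) in \<open>simp_all add: vars_def graph_loaded_def\<close>)
  have found: "exec N (any_time n (any_time n 1))
      (Any ''found'' ''p''
       (Any ''hit'' ''u'' skip
         (And (In_S ''u'') (And (Neq (V ''u'') (V ''v'')) (Not (And (Not (Adj ''p'' ''u'')) (Neq (V ''u'') (V ''p'')))))))
       (And (Adj ''v'' ''p'') (Less (V ''hit'') (Num 1))))
      s1 (\<lambda>L s'. L = [] \<and> (\<forall>x. x \<notin> {''hit'', ''u''} \<union> {''p'', ''found''} \<longrightarrow> s' x = s1 x) \<and>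
        s' ''found'' 0 = (if \<exists>p<n. priv (s1 ''v'' 0) p then 1 else 0))"
    if s1: "graph_loaded n E s1" "stores_set n S s1" "s1 ''v'' 0 < n" for s1
  proof (rule exec_Any)
    fix k s' assume s': "k < n" "s' ''p'' 0 = k" "\<forall>x. x \<notin> {''hit'', ''u''} \<union> {''p'', ''found''} \<longrightarrow> s' x = s1 x"
    then have inv: "graph_loaded n E s'" "stores_set n S s'" "s' ''v'' 0 = s1 ''v'' 0"
      using s1 graph_loaded_cong[of s' s1] stores_set_cong[of s' s1] by auto
    show "exec N (any_time n 1) (Any ''hit'' ''u'' skip
         (And (In_S ''u'') (And (Neq (V ''u'') (V ''v'')) (Not (And (Not (Adj ''p'' ''u'')) (Neq (V ''u'') (V ''p'')))))))
        s' (\<lambda>L s''. L = [] \<and> (\<forall>x. x \<notin> {''hit'', ''u''} \<longrightarrow> s'' x = s' x) \<and>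
        (bval (And (Adj ''v'' ''p'') (Less (V ''hit'') (Num 1))) s'' \<longleftrightarrow>
         priv (s1 ''v'' 0) k))"
    proof (rule exec_conseq[OF hit[OF inv(1,2)]])
      fix L :: "nat list list" and s''
      assume *: "L = [] \<and> (\<forall>x. x \<notin> {} \<union> {''u'', ''hit''} \<longrightarrow> s'' x = s' x) \<and>
        s'' ''hit'' 0 = (if \<exists>u<n. hitting (s' ''v'' 0) (s' ''p'' 0) u then 1 else 0)"
      then have "graph_loaded n E s''" "s'' ''p'' 0 = k" "s'' ''v'' 0 = s1 ''v'' 0"
        using inv s' graph_loaded_cong[of s'' s'] by auto
      then have 1: "bval (Adj ''v'' ''p'') s'' \<longleftrightarrow> (s1 ''v'' 0, k) \<in> E"
        using s'(1) s1(3) bval_Adj[of n E s'' "''v''" "''p''"] by metis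
      have 2: "aval (V ''hit'') s'' = (if \<exists>u<n. hitting (s1 ''v'' 0) k u then 1 else 0)"
        using * inv(3) s'(2) by simp
      have "bval (And (Adj ''v'' ''p'') (Less (V ''hit'') (Num 1))) s'' \<longleftrightarrow> priv (s1 ''v'' 0) k"
        unfolding bval.simps(3) bval_less_one 1 2 priv_def by simp
      moreover have "\<forall>x. x \<notin> {''hit'', ''u''} \<longrightarrow> s'' x = s' x" using * by blast
      ultimately show "L = [] \<and> (\<forall>x. x \<notin> {''hit'', ''u''} \<longrightarrow> s'' x = s' x) \<and>
        (bval (And (Adj ''v'' ''p'') (Less (V ''hit'') (Num 1))) s'' \<longleftrightarrow> priv (s1 ''v'' 0) k)"
        using * by blast
    qed (simp_all add: s'(1,2))
  qed (use assms(4) s1(1) in \<open>simp_all add: vars_def graph_loaded_def\<close>)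
  have "exec N (any_time n (any_time n (any_time n 1))) Check s
    (\<lambda>L s'. L = [] \<and> (\<forall>x. x \<notin> {''found'', ''p'', ''hit'', ''u''} \<union> {''v'', ''bad''} \<longrightarrow> s' x = s x) \<and>
      s' ''bad'' 0 = (if \<exists>v<n. v \<in> S \<and> \<not> (\<exists>p<n. priv v p) then 1 else 0))"
    unfolding Check_def
  proof (rule exec_Any)
    fix k s' assume s': "k < n" "s' ''v'' 0 = k" "\<forall>x. x \<notin> {''found'', ''p'', ''hit'', ''u''} \<union> {''v'', ''bad''} \<longrightarrow> s' x = s x"
    then have inv: "graph_loaded n E s'" "stores_set n S s'" "s' ''v'' 0 < n"
      using assms graph_loaded_cong[of s' s] stores_set_cong[of s' s] by auto
    show "exec N (any_time n (any_time n 1))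
      (Any ''found'' ''p''
       (Any ''hit'' ''u'' skip
         (And (In_S ''u'') (And (Neq (V ''u'') (V ''v'')) (Not (And (Not (Adj ''p'' ''u'')) (Neq (V ''u'') (V ''p'')))))))
       (And (Adj ''v'' ''p'') (Less (V ''hit'') (Num 1))))
      s' (\<lambda>L s''. L = [] \<and> (\<forall>x. x \<notin> {''found'', ''p'', ''hit'', ''u''} \<longrightarrow> s'' x = s' x) \<and>
        (bval (And (In_S ''v'') (Less (V ''found'') (Num 1))) s'' \<longleftrightarrow>
         k \<in> S \<and> \<not> (\<exists>p<n. priv k p)))"
    proof (rule exec_conseq[OF found[OF inv]])
      fix L :: "nat list list" and s''
      assume *: "L = [] \<and> (\<forall>x. x \<notin> {''hit'', ''u''} \<union> {''p'', ''found''} \<longrightarrow> s'' x = s' x) \<and>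
        s'' ''found'' 0 = (if \<exists>p<n. priv (s' ''v'' 0) p then 1 else 0)"
      then have "stores_set n S s''" "s'' ''v'' 0 = k"
        using inv s' stores_set_cong[of s'' s'] by auto
      then have 1: "bval (In_S ''v'') s'' \<longleftrightarrow> k \<in> S"
        using s'(1) bval_In_S[of n S s'' "''v''"] by metis
      have 2: "aval (V ''found'') s'' = (if \<exists>p<n. priv k p then 1 else 0)"
        using * s'(2) by simp
      have "bval (And (In_S ''v'') (Less (V ''found'') (Num 1))) s'' \<longleftrightarrow> k \<in> S \<and> \<not> (\<exists>p<n. priv k p)"
        unfolding bval.simps(3) bval_less_one 1 2 by simp
      moreover have "\<forall>x. x \<notin> {''found'', ''p'', ''hit'', ''u''} \<longrightarrow> s'' x = s' x" using * by blast
      ultimately show "L = [] \<and> (\<forall>x. x \<notin> {''found'', ''p'', ''hit'', ''u''} \<longrightarrow> s'' x = s' x) \<and>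
        (bval (And (In_S ''v'') (Less (V ''found'') (Num 1))) s'' \<longleftrightarrow> k \<in> S \<and> \<not> (\<exists>p<n. priv k p))"
        using * by blast
    qed simp
  qed (use assms(4) n in \<open>simp_all add: vars_def\<close>)
  moreover have "(\<exists>v<n. v \<in> S \<and> \<not> (\<exists>p<n. priv v p)) \<longleftrightarrow> \<not> open_irredundant n E S"
  proof -
    have "(\<exists>u<n. hitting v p u) \<longleftrightarrow> \<not> (\<forall>u\<in>S. u \<noteq> v \<longrightarrow> u \<noteq> p \<and> (p, u) \<notin> E)" for v p
      using assms(3) by (auto simp: hitting_def)
    then show ?thesis
      using assms(3) by (auto simp: open_irredundant_def priv_def)
  qed
  ultimately have *: "exec N (any_time n (any_time n (any_time n 1))) Check s
    (\<lambda>L s'. L = [] \<and> (\<forall>x. x \<notin> {''found'', ''p'', ''hit'', ''u''} \<union> {''v'', ''bad''} \<longrightarrow> s' x = s x) \<and>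
      s' ''bad'' 0 = (if \<not> open_irredundant n E S then 1 else 0))"
    by simp
  show ?thesis by (rule exec_conseq[OF *]) auto
qed

lemma exec_Fill:
  assumes "graph_loaded n E s" "stores_set n S s" "n + 2 \<le> N"
  shows "exec N (n * ((any_time n 1 + (1 + 1) + 1) + 3) + 3) Fill s
    (\<lambda>L s'. L = [] \<and> (\<forall>x. x \<notin> {''v'', ''u'', ''hit'', ''f''} \<longrightarrow> s' x = s x) \<and>
      (\<forall>v<n. s' ''f'' v = roman_of n E S v))"
proof -
  define Inv where "Inv = (\<lambda>k s'. (\<forall>x. x \<notin> {''v'', ''u'', ''hit'', ''f''} \<longrightarrow> s' x = s x) \<and>
      (\<forall>v<k. s' ''f'' v = roman_of n E S v))"
  have "exec N (n * ((any_time n 1 + (1 + 1) + 1) + 3) + 3) Fill s (\<lambda>L s'. L = [] \<and> Inv n s')"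
    unfolding Fill_def
  proof (rule exec_For[where Inv = Inv])
    fix k s1 assume s1: "k < n" "s1 ''v'' 0 = k" "s1 ''n'' 0 = n" "Inv k s1"
    then have inv: "graph_loaded n E s1" "stores_set n S s1"
      using assms graph_loaded_cong[of s1 s] stores_set_cong[of s1 s] by (auto simp: Inv_def)
    have "exec N (any_time n 1) (Any ''hit'' ''u'' skip (And (In_S ''u'') (Adj ''v'' ''u'')))
      s1 (\<lambda>L s'. L = [] \<and> (\<forall>x. x \<notin> {} \<union> {''u'', ''hit''} \<longrightarrow> s' x = s1 x) \<and>
        s' ''hit'' 0 = (if \<exists>u<n. u \<in> S \<and> (k, u) \<in> E then 1 else 0))"
    proof (rule exec_Any)
      fix j s' assume s': "j < n" "s' ''u'' 0 = j" "\<forall>x. x \<notin> {} \<union> {''u'', ''hit''} \<longrightarrow> s' x = s1 x"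
      then have "graph_loaded n E s'" "stores_set n S s'" "s' ''v'' 0 = k"
        using s1 inv graph_loaded_cong[of s' s1] stores_set_cong[of s' s1] by auto
      then show "exec N 1 skip s' (\<lambda>L s''. L = [] \<and> (\<forall>x. x \<notin> {} \<longrightarrow> s'' x = s' x) \<and>
          (bval (And (In_S ''u'') (Adj ''v'' ''u'')) s'' \<longleftrightarrow> j \<in> S \<and> (k, j) \<in> E))"
        using s' s1 bval_Adj[of n E s' "''v''" "''u''"] bval_In_S[of n S s' "''u''"]
        by (intro exec_skip) auto
    qed (use assms s1 in \<open>auto simp: vars_def\<close>)
    then show "exec N (any_time n 1 + (1 + 1) + 1)
        (Seq (Any ''hit'' ''u'' skip (And (In_S ''u'') (Adj ''v'' ''u'')))
          (If (In_S ''v'') (Assign ''f'' (V ''v'') (Num 2)) (Assign ''f'' (V ''v'') (Minus (Num 1) (V ''hit'')))))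
        s1 (\<lambda>L s'. L = [] \<and> s' ''v'' 0 = k \<and> s' ''n'' 0 = n \<and> Inv (Suc k) (s'(''v'' := (s' ''v'')(0 := Suc k))))"
    proof (intro exec_Seq, elim exec_conseq)
      fix L :: "nat list list" and s2
      assume s2: "L = [] \<and> (\<forall>x. x \<notin> {} \<union> {''u'', ''hit''} \<longrightarrow> s2 x = s1 x) \<and>
        s2 ''hit'' 0 = (if \<exists>u<n. u \<in> S \<and> (k, u) \<in> E then 1 else 0)"
      then have "stores_set n S s2" "s2 ''v'' 0 = k"
        using inv s1 stores_set_cong[of s2 s1] by auto
      then have "bval (In_S ''v'') s2 \<longleftrightarrow> k \<in> S"
        using s1 bval_In_S[of n S s2 "''v''"] by simp
      then show "exec N (1 + 1)
          (If (In_S ''v'') (Assign ''f'' (V ''v'') (Num 2)) (Assign ''f'' (V ''v'') (Minus (Num 1) (V ''hit''))))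
          s2 (\<lambda>M s'. L @ M = [] \<and> s' ''v'' 0 = k \<and> s' ''n'' 0 = n \<and> Inv (Suc k) (s'(''v'' := (s' ''v'')(0 := Suc k))))"
        using s1 s2 assms(3)
        by (intro exec_If exec_Assign) (auto simp: vars_def Inv_def less_Suc_eq roman_of_def)
    qed simp
  qed (use assms in \<open>auto simp: Inv_def vars_def graph_loaded_def\<close>)
  then show ?thesis by (rule exec_conseq) (auto simp: Inv_def)
qed

section \<open>The backtracking loop and its single steps\<close>

definition Rows :: com where
  "Rows = For ''v'' (Assign ''row'' (Plus (V ''v'') (Num 1)) (Plus (Cell ''row'' (V ''v'')) (V ''n'')))"

definition Push :: com where
  "Push = Seq (Assign ''stk'' (V ''sz'') (V ''j'')) (Assign ''sz'' (Num 0) (Plus (V ''sz'') (Num 1)))"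

definition Try :: com where
  "Try = Seq (Assign ''S'' (V ''j'') (Num 1)) (Seq Check (Seq
     (If (Less (Num 0) (V ''bad'')) (Assign ''S'' (V ''j'') (Num 0))
       (Seq Fill (Seq (Output ''f'' (V ''n'')) Push)))
     (Assign ''j'' (Num 0) (Plus (V ''j'') (Num 1)))))"

definition Pop :: com where
  "Pop = Seq (Assign ''sz'' (Num 0) (Minus (V ''sz'') (Num 1))) (Seq
     (Assign ''j'' (Num 0) (Cell ''stk'' (V ''sz''))) (Seq
     (Assign ''S'' (V ''j'') (Num 0))
     (Assign ''j'' (Num 0) (Plus (V ''j'') (Num 1)))))"

definition Body :: com where
  "Body = If (Less (V ''j'') (V ''n'')) Try Pop"

text \<open>By truncated subtraction the sum is positive iff the stack is nonempty or j < n; this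
  replaces a disjunction.\<close>

definition Loop :: com where
  "Loop = While (Less (Num 0) (Plus (V ''sz'') (Minus (V ''n'') (V ''j'')))) Body"

text \<open>The empty set is the root of the search and is output here; the loop only outputs proper
  extensions.\<close>

definition Pre :: com where
  "Pre = Seq Rows (Seq Fill (Output ''f'' (V ''n'')))"

definition Enumerate :: com where
  "Enumerate = Seq Pre Loop"

text \<open>
  The stack \<open>xs\<close> lists the current set in increasing order, and \<open>j\<close> is the next vertex to be tried.
\<close>

definition rep :: "nat \<Rightarrow> (nat \<times> nat) set \<Rightarrow> nat list \<Rightarrow> nat \<Rightarrow> mem \<Rightarrow> bool" where
  "rep n E xs j s \<longleftrightarrow> graph_loaded n E s \<and> stores_set n (set xs) s \<and> s ''j'' 0 = j \<and>
     s ''sz'' 0 = length xs \<and> (\<forall>i<length xs. s ''stk'' i = xs ! i) \<and>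
     sorted_wrt (<) (xs @ [j]) \<and> j \<le> n"

abbreviation fill_time :: "nat \<Rightarrow> nat" where
  "fill_time n \<equiv> n * ((any_time n 1 + (1 + 1) + 1) + 3) + 3"

abbreviation check_time :: "nat \<Rightarrow> nat" where
  "check_time n \<equiv> any_time n (any_time n (any_time n 1))"

text \<open>Each round writes the entry after the current one, so the last value stored is n * n.
  This is the reason for the quadratic term in the lower bound for N.\<close>

lemma exec_Rows:
  assumes "s ''n'' 0 = n" "s ''row'' 0 = 0" "n * n + n + 2 \<le> N"
  shows "exec N (n * (1 + 3) + 3) Rows s
    (\<lambda>L s'. L = [] \<and> (\<forall>x. x \<notin> {''v'', ''row''} \<longrightarrow> s' x = s x) \<and> (\<forall>i\<le>n. s' ''row'' i = i * n))"
proof -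
  define Inv where "Inv = (\<lambda>k s'. (\<forall>x. x \<notin> {''v'', ''row''} \<longrightarrow> s' x = s x) \<and> (\<forall>i\<le>k. s' ''row'' i = i * n))"
  have "exec N (n * (1 + 3) + 3) Rows s (\<lambda>L s'. L = [] \<and> Inv n s')"
    unfolding Rows_def
  proof (rule exec_For[where Inv = Inv])
    fix k s1 assume s1: "k < n" "s1 ''v'' 0 = k" "s1 ''n'' 0 = n" "Inv k s1"
    then have row: "s1 ''row'' k = k * n" by (simp add: Inv_def)
    have "Suc k * n \<le> n * n" using s1(1) by (intro mult_le_mono1) simp
    then have "k * n + n \<le> N" using assms(3) by simp
    then show "exec N 1 (Assign ''row'' (Plus (V ''v'') (Num 1)) (Plus (Cell ''row'' (V ''v'')) (V ''n''))) s1
        (\<lambda>L s'. L = [] \<and> s' ''v'' 0 = k \<and> s' ''n'' 0 = n \<and> Inv (Suc k) (s'(''v'' := (s' ''v'')(0 := Suc k))))"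
      using s1 row assms(3)
      by (intro exec_Assign) (auto simp: vars_def Inv_def le_Suc_eq)
  qed (use assms in \<open>auto simp: Inv_def vars_def\<close>)
  then show ?thesis by (rule exec_conseq) (auto simp: Inv_def)
qed

lemma rep_bounds:
  assumes "rep n E xs j s"
  shows "set xs \<subseteq> {..<j}" "length xs \<le> n" "j \<notin> set xs"
proof -
  show xs: "set xs \<subseteq> {..<j}" using assms by (auto simp: rep_def sorted_wrt_append)
  then show "j \<notin> set xs" by auto
  have "distinct xs"
    using assms by (auto simp: rep_def sorted_wrt_append strict_sorted_iff)
  then have "length xs = card (set xs)" by (simp add: distinct_card)
  also have "\<dots> \<le> card {..<j}" using xs by (intro card_mono) auto
  finally show "length xs \<le> n" using assms by (simp add: rep_def)
qed

lemma exec_Try: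
  assumes rep: "rep n E xs j s" and "j < n" "n * n + n + 2 \<le> N"
  shows "exec N (check_time n + fill_time n + 20) Try s (\<lambda>L s'.
    if open_irredundant n E (insert j (set xs))
    then L = [map (roman_of n E (insert j (set xs))) [0..<n]] \<and> rep n E (xs @ [j]) (Suc j) s'
    else L = [] \<and> rep n E xs (Suc j) s')" (is "exec _ _ _ _ ?Q")
proof -
  let ?S = "insert j (set xs)"
  define s1 where "s1 = s(''S'' := (s ''S'')(j := 1))"
  have s: "graph_loaded n E s" "stores_set n (set xs) s" "s ''j'' 0 = j" "s ''sz'' 0 = length xs"
    "\<forall>i<length xs. s ''stk'' i = xs ! i" "sorted_wrt (<) (xs @ [j])"
    using rep by (auto simp: rep_def)
  note bounds = rep_bounds[OF rep]
  have s1: "graph_loaded n E s1" "stores_set n ?S s1"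
    using s graph_loaded_cong[of s1 s] by (auto simp: s1_def stores_set_def)
  have S: "?S \<subseteq> {..<n}" using bounds assms(2) by auto
  have n: "n < N" "n + 2 \<le> N" using assms(3) by auto
  \<comment> \<open>The sum mirrors the syntax tree of the command, so that the rules for
    \<open>Seq\<close> and \<open>If\<close> unify with it; it is rounded up at the end.\<close>
  have "exec N (1 + (check_time n + (((fill_time n + (1 + (1 + 1 + 1) + 1) + 1) + 1) + 1 + 1) + 1) + 1) Try s ?Q"
    unfolding Try_def
  proof (rule exec_Seq, rule exec_Assign, unfold append_Nil)
    have "exec N (check_time n + (((fill_time n + (1 + (1 + 1 + 1) + 1) + 1) + 1) + 1 + 1) + 1)
      (Seq Check (Seq (If (Less (Num 0) (V ''bad'')) (Assign ''S'' (V ''j'') (Num 0))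
         (Seq Fill (Seq (Output ''f'' (V ''n'')) Push))) (Assign ''j'' (Num 0) (Plus (V ''j'') (Num 1))))) s1 ?Q"
    proof (rule exec_Seq, rule exec_conseq[OF exec_Check[OF s1 S n(1)]])
      fix L :: "nat list list" and s2
      assume *: "L = [] \<and> (\<forall>x. x \<notin> {''bad'', ''v'', ''found'', ''p'', ''hit'', ''u''} \<longrightarrow> s2 x = s1 x) \<and>
        (s2 ''bad'' 0 = 0 \<longleftrightarrow> open_irredundant n E ?S)"
      then have eq2: "s2 ''n'' = s ''n''" "s2 ''row'' = s ''row''" "s2 ''adj'' = s ''adj''" "s2 ''S'' = (s ''S'')(j := 1)"
        "s2 ''j'' = s ''j''" "s2 ''sz'' = s ''sz''" "s2 ''stk'' = s ''stk''"
        by (auto simp: s1_def)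
      have s2: "graph_loaded n E s2" "stores_set n ?S s2"
        using s1 graph_loaded_cong[of s2 s1] stores_set_cong[of s2 s1] by (auto simp: eq2 s1_def)
      have L: "L = []" and bad: "s2 ''bad'' 0 = 0 \<longleftrightarrow> open_irredundant n E ?S" using * by auto
      show "exec N (((fill_time n + (1 + (1 + 1 + 1) + 1) + 1) + 1) + 1 + 1)
        (Seq (If (Less (Num 0) (V ''bad'')) (Assign ''S'' (V ''j'') (Num 0))
         (Seq Fill (Seq (Output ''f'' (V ''n'')) Push))) (Assign ''j'' (Num 0) (Plus (V ''j'') (Num 1)))) s2
        (\<lambda>M. ?Q (L @ M))"
        unfolding L append_Nil
      proof (rule exec_Seq, rule exec_If)
        assume "bval (Less (Num 0) (V ''bad'')) s2"
        then have invalid: "\<not> open_irredundant n E ?S" using bad by simp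
        show "exec N (fill_time n + (1 + (1 + 1 + 1) + 1) + 1) (Assign ''S'' (V ''j'') (Num 0)) s2
          (\<lambda>L s'. exec N 1 (Assign ''j'' (Num 0) (Plus (V ''j'') (Num 1))) s' (\<lambda>M. ?Q (L @ M)))"
        proof (rule exec_Assign, unfold append_Nil, rule exec_Assign)
          let ?s3 = "s2(''S'' := (s2 ''S'')(aval (V ''j'') s2 := aval (Num 0) s2))"
          let ?s4 = "?s3(''j'' := (?s3 ''j'')(aval (Num 0) ?s3 := aval (Plus (V ''j'') (Num 1)) ?s3))"
          have "graph_loaded n E ?s4" using s2(1) graph_loaded_cong[of ?s4 s2] by simp
          moreover have "stores_set n (set xs) ?s4"
            using s(2,3) bounds(3) by (auto simp: stores_set_def eq2)
          moreover have "sorted_wrt (<) (xs @ [Suc j])"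
            using s(6) by (auto simp: sorted_wrt_append)
          ultimately have "rep n E xs (Suc j) ?s4"
            using s assms(2) by (simp add: rep_def eq2)
          then show "?Q [] ?s4" using invalid by simp
        qed (use s assms(2,3) in \<open>auto simp: vars_def eq2\<close>)
      next
        assume "\<not> bval (Less (Num 0) (V ''bad'')) s2"
        then have valid: "open_irredundant n E ?S" using bad by simp
        show "exec N (fill_time n + (1 + (1 + 1 + 1) + 1) + 1) (Seq Fill (Seq (Output ''f'' (V ''n'')) Push)) s2
          (\<lambda>L s'. exec N 1 (Assign ''j'' (Num 0) (Plus (V ''j'') (Num 1))) s' (\<lambda>M. ?Q (L @ M)))"
        proof (rule exec_Seq, rule exec_conseq[OF exec_Fill[OF s2 n(2)]])
          fix L :: "nat list list" and s3
          assume *: "L = [] \<and> (\<forall>x. x \<notin> {''v'', ''u'', ''hit'', ''f''} \<longrightarrow> s3 x = s2 x) \<and>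
            (\<forall>v<n. s3 ''f'' v = roman_of n E ?S v)"
          then have eq3: "s3 ''n'' = s ''n''" "s3 ''row'' = s ''row''" "s3 ''adj'' = s ''adj''" "s3 ''S'' = (s ''S'')(j := 1)"
            "s3 ''j'' = s ''j''" "s3 ''sz'' = s ''sz''" "s3 ''stk'' = s ''stk''"
            using eq2 by auto
          have L: "L = []" using * by blast
          have out: "map (s3 ''f'') [0..<aval (V ''n'') s3] = map (roman_of n E ?S) [0..<n]"
            using * s(1) by (auto simp: eq3 graph_loaded_def)
          show "exec N (1 + (1 + 1 + 1) + 1) (Seq (Output ''f'' (V ''n'')) Push) s3
            (\<lambda>M s'. exec N 1 (Assign ''j'' (Num 0) (Plus (V ''j'') (Num 1))) s' (\<lambda>M'. ?Q ((L @ M) @ M')))"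
            unfolding L append_Nil Push_def
          proof (rule exec_Seq, rule exec_Output, unfold out,
              rule exec_Seq, rule exec_Assign, rule exec_Assign, rule exec_Assign)
            let ?s4 = "s3(''stk'' := (s3 ''stk'')(aval (V ''sz'') s3 := aval (V ''j'') s3))"
            let ?s5 = "?s4(''sz'' := (?s4 ''sz'')(aval (Num 0) ?s4 := aval (Plus (V ''sz'') (Num 1)) ?s4))"
            let ?s6 = "?s5(''j'' := (?s5 ''j'')(aval (Num 0) ?s5 := aval (Plus (V ''j'') (Num 1)) ?s5))"
            have "graph_loaded n E ?s6"
              using s(1) graph_loaded_cong[of ?s6 s] by (simp add: eq3)
            moreover have "stores_set n (set (xs @ [j])) ?s6"
              using s(2) by (auto simp: stores_set_def eq3)
            moreover have "sorted_wrt (<) ((xs @ [j]) @ [Suc j])"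
              using s(6) by (auto simp: sorted_wrt_append)
            moreover have "\<forall>i<length (xs @ [j]). ?s6 ''stk'' i = (xs @ [j]) ! i"
              using s(3-5) by (auto simp: eq3 nth_append)
            ultimately have "rep n E (xs @ [j]) (Suc j) ?s6"
              using s(3,4) assms(2) by (simp add: rep_def eq3)
            then show "?Q (([map (roman_of n E ?S) [0..<n]] @ [] @ []) @ []) ?s6" using valid by simp
          qed (use s bounds assms(2,3) in \<open>auto simp: vars_def eq3\<close>)
        qed simp
      qed
    qed simp
    then show "exec N (check_time n + (((fill_time n + (1 + (1 + 1 + 1) + 1) + 1) + 1) + 1 + 1) + 1)
      (Seq Check (Seq (If (Less (Num 0) (V ''bad'')) (Assign ''S'' (V ''j'') (Num 0))
         (Seq Fill (Seq (Output ''f'' (V ''n'')) Push))) (Assign ''j'' (Num 0) (Plus (V ''j'') (Num 1)))))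
      (s(''S'' := (s ''S'')(aval (V ''j'') s := aval (Num 1) s))) ?Q"
      using s(3) by (simp add: s1_def)
  qed (use s assms(2,3) in \<open>auto simp: vars_def\<close>)
  then show ?thesis by (rule exec_conseq) auto
qed

lemma exec_Pop:
  assumes rep: "rep n E (ys @ [m]) j s" and "n * n + n + 2 \<le> N"
  shows "exec N 7 Pop s (\<lambda>L s'. L = [] \<and> rep n E ys (Suc m) s')"
proof -
  have s: "graph_loaded n E s" "stores_set n (set (ys @ [m])) s" "s ''j'' 0 = j" "s ''sz'' 0 = Suc (length ys)"
    "\<forall>i<Suc (length ys). s ''stk'' i = (ys @ [m]) ! i" "sorted_wrt (<) ((ys @ [m]) @ [j])" "j \<le> n"
    using rep by (auto simp: rep_def)
  have m: "m < j" "m \<notin> set ys" "sorted_wrt (<) (ys @ [Suc m])"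
    using s(6) by (auto simp: sorted_wrt_append)
  have stk: "s ''stk'' (length ys) = m" "\<forall>i<length ys. s ''stk'' i = ys ! i"
    using s(5) by (auto simp: nth_append)
  have "length ys \<le> n" using rep_bounds(2)[OF rep] by simp
  have "exec N (1 + (1 + (1 + 1 + 1) + 1) + 1) Pop s (\<lambda>L s'. L = [] \<and> rep n E ys (Suc m) s')"
    unfolding Pop_def
  proof (rule exec_Seq, rule exec_Assign, rule exec_Seq, rule exec_Assign,
      rule exec_Seq, rule exec_Assign, rule exec_Assign)
    let ?s1 = "s(''sz'' := (s ''sz'')(aval (Num 0) s := aval (Minus (V ''sz'') (Num 1)) s))"
    let ?s2 = "?s1(''j'' := (?s1 ''j'')(aval (Num 0) ?s1 := aval (Cell ''stk'' (V ''sz'')) ?s1))"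
    let ?s3 = "?s2(''S'' := (?s2 ''S'')(aval (V ''j'') ?s2 := aval (Num 0) ?s2))"
    let ?s4 = "?s3(''j'' := (?s3 ''j'')(aval (Num 0) ?s3 := aval (Plus (V ''j'') (Num 1)) ?s3))"
    have "graph_loaded n E ?s4"
      using s(1) graph_loaded_cong[of ?s4 s] by simp
    moreover have "stores_set n (set ys) ?s4"
      using s(2,4) m stk by (auto simp: stores_set_def)
    ultimately have "rep n E ys (Suc m) ?s4"
      using s m stk by (simp add: rep_def)
    then show "[] @ [] @ [] @ [] = [] \<and> rep n E ys (Suc m) ?s4" by simp
  qed (use s m stk assms(2) \<open>length ys \<le> n\<close> in \<open>auto simp: vars_def\<close>)
  then show ?thesis by (rule exec_conseq) auto
qed

lemma exec_Body_Try:
  assumes "rep n E xs j s" "j < n" "n * n + n + 2 \<le> N"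
  shows "exec N (check_time n + fill_time n + 21) Body s (\<lambda>L s'.
    if open_irredundant n E (insert j (set xs))
    then L = [map (roman_of n E (insert j (set xs))) [0..<n]] \<and> rep n E (xs @ [j]) (Suc j) s'
    else L = [] \<and> rep n E xs (Suc j) s')"
proof -
  have "exec N (check_time n + fill_time n + 20 + 1) Body s (\<lambda>L s'.
    if open_irredundant n E (insert j (set xs))
    then L = [map (roman_of n E (insert j (set xs))) [0..<n]] \<and> rep n E (xs @ [j]) (Suc j) s'
    else L = [] \<and> rep n E xs (Suc j) s')"
    unfolding Body_def
  proof (rule exec_If)
    assume "\<not> bval (Less (V ''j'') (V ''n'')) s"
    then show "exec N (check_time n + fill_time n + 20) Pop s (\<lambda>L s'.
      if open_irredundant n E (insert j (set xs))
      then L = [map (roman_of n E (insert j (set xs))) [0..<n]] \<and> rep n E (xs @ [j]) (Suc j) s'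
      else L = [] \<and> rep n E xs (Suc j) s')"
      using assms(1,2) by (simp add: rep_def graph_loaded_def)
  qed (rule exec_Try[OF assms])
  then show ?thesis by (rule exec_conseq) auto
qed

lemma exec_Body_Pop:
  assumes "rep n E (ys @ [m]) n s" "n * n + n + 2 \<le> N"
  shows "exec N (check_time n + fill_time n + 21) Body s (\<lambda>L s'. L = [] \<and> rep n E ys (Suc m) s')"
proof -
  have "exec N (7 + 1) Body s (\<lambda>L s'. L = [] \<and> rep n E ys (Suc m) s')"
    unfolding Body_def
  proof (rule exec_If)
    assume "bval (Less (V ''j'') (V ''n'')) s"
    then show "exec N 7 Try s (\<lambda>L s'. L = [] \<and> rep n E ys (Suc m) s')"
      using assms(1) by (simp add: rep_def graph_loaded_def)
  qed (rule exec_Pop[OF assms])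
  then show ?thesis by (rule exec_conseq) auto
qed

lemma exec_Pre:
  assumes "s ''n'' 0 = n" "s ''row'' 0 = 0" "s ''S'' = (\<lambda>_. 0)" "s ''j'' 0 = 0" "s ''sz'' 0 = 0"
    "\<forall>i<n. \<forall>j<n. s ''adj'' (i * n + j) = (if (i, j) \<in> E then 1 else 0)" "n * n + n + 2 \<le> N"
  shows "exec N (4 * n + fill_time n + 6) Pre s
    (\<lambda>L s'. L = [map (roman_of n E {}) [0..<n]] \<and> rep n E [] 0 s')"
proof -
  have "exec N ((n * (1 + 3) + 3) + (fill_time n + 1 + 1) + 1) Pre s
    (\<lambda>L s'. L = [map (roman_of n E {}) [0..<n]] \<and> rep n E [] 0 s')"
    unfolding Pre_def
  proof (rule exec_Seq, rule exec_conseq[OF exec_Rows[where s = s and n = n and N = N, OF assms(1,2,7)]])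
    fix L :: "nat list list" and s1
    assume *: "L = [] \<and> (\<forall>x. x \<notin> {''v'', ''row''} \<longrightarrow> s1 x = s x) \<and> (\<forall>i\<le>n. s1 ''row'' i = i * n)"
    then have s1: "graph_loaded n E s1" "stores_set n {} s1" "s1 ''j'' 0 = 0" "s1 ''sz'' 0 = 0"
      using assms by (auto simp: graph_loaded_def stores_set_def)
    have L: "L = []" and "n + 2 \<le> N" using * assms(7) by auto
    show "exec N (fill_time n + 1 + 1) (Seq Fill (Output ''f'' (V ''n''))) s1
      (\<lambda>M s'. L @ M = [map (roman_of n E {}) [0..<n]] \<and> rep n E [] 0 s')"
      unfolding L append_Nil
    proof (rule exec_Seq, rule exec_conseq[OF exec_Fill[OF s1(1,2) \<open>n + 2 \<le> N\<close>]])
      fix L :: "nat list list" and s2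
      assume *: "L = [] \<and> (\<forall>x. x \<notin> {''v'', ''u'', ''hit'', ''f''} \<longrightarrow> s2 x = s1 x) \<and>
        (\<forall>v<n. s2 ''f'' v = roman_of n E {} v)"
      then have "rep n E [] 0 s2"
        using s1 graph_loaded_cong[of s2 s1] stores_set_cong[of s2 s1] by (simp add: rep_def)
      moreover from this have "s2 ''n'' 0 = n" by (simp add: rep_def graph_loaded_def)
      ultimately show "exec N 1 (Output ''f'' (V ''n'')) s2
          (\<lambda>M s'. L @ M = [map (roman_of n E {}) [0..<n]] \<and> rep n E [] 0 s')"
        using * by (intro exec_Output) simp
    qed simp
  qed simp
  then show ?thesis by (rule exec_conseq) auto
qed

section \<open>Delay, running time and space\<close>

text \<open>A bound on every silent stretch starting in k, whether it ends with an output or with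
  termination.\<close>

definition gap :: "nat \<Rightarrow> config \<Rightarrow> bool" where
  "gap \<Delta> k \<longleftrightarrow> (\<forall>m. (\<forall>u<m. emitted ((step ^^ u) k) = None \<and> fst ((step ^^ u) k) \<noteq> []) \<longrightarrow> m \<le> \<Delta>)"

text \<open>Required at all times up to T, so that it can be used at each output without knowing
  when outputs occur.\<close>

definition steady :: "nat \<Rightarrow> config \<Rightarrow> nat \<Rightarrow> bool" where
  "steady \<Delta> k T \<longleftrightarrow> (\<forall>t\<le>T. gap \<Delta> ((step ^^ t) k))"

lemma gap_mono: "gap \<Delta> k \<Longrightarrow> \<Delta> \<le> \<Delta>' \<Longrightarrow> gap \<Delta>' k"
  unfolding gap_def by (meson le_trans)

lemma steady_mono: "steady \<Delta> k T \<Longrightarrow> \<Delta> \<le> \<Delta>' \<Longrightarrow> steady \<Delta>' k T"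
  unfolding steady_def by (meson gap_mono)

text \<open>An output within the t steps ends the silent stretch, so k' matters only if L is empty.
  Hence the potential in \<open>Loop_gap\<close> is free to grow in iterations that output.\<close>

lemma gap_before:
  assumes "L = [] \<Longrightarrow> gap \<Delta> k'" "trace N k t k' L"
  shows "gap (t + \<Delta>) k"
  unfolding gap_def
proof (intro allI impI)
  fix m assume silent: "\<forall>u<m. emitted ((step ^^ u) k) = None \<and> fst ((step ^^ u) k) \<noteq> []"
  show "m \<le> t + \<Delta>"
  proof (cases "m \<le> t")
    case False
    have "outs k t = []" using silent False by (simp add: outs_eq_Nil)
    then have "gap \<Delta> k'" using assms by (simp add: trace_def)
    moreover have "emitted ((step ^^ u) k') = None \<and> fst ((step ^^ u) k') \<noteq> []" if "u < m - t" for u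
    proof -
      have "(step ^^ u) k' = (step ^^ (t + u)) k" using assms(2) by (simp add: trace_def step_add)
      moreover have "t + u < m" using that by simp
      ultimately show ?thesis using silent by metis
    qed
    ultimately have "m - t \<le> \<Delta>" unfolding gap_def by blast
    then show ?thesis by simp
  qed simp
qed

lemma trace_suffix:
  assumes "trace N k t k' L" "u \<le> t"
  obtains M where "trace N ((step ^^ u) k) (t - u) k' M"
proof -
  obtain v where v: "t = u + v" using assms(2) le_Suc_ex by blast
  have "fst ((step ^^ w) ((step ^^ u) k)) \<noteq> [] \<and> bounded_mem N (snd ((step ^^ w) ((step ^^ u) k)))" if "w < v" for w
    using assms(1) that unfolding v trace_def step_add [symmetric] by simp
  then have "trace N ((step ^^ u) k) v k' (outs ((step ^^ u) k) v)"
    using assms(1) unfolding v trace_def by (simp add: step_add)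
  then show ?thesis using that v by simp
qed

lemma steady_trace:
  assumes "trace N k t k' L" "gap \<Gamma> k'" "t + \<Gamma> \<le> \<Delta>"
  shows "steady \<Delta> k t"
  unfolding steady_def
proof (intro allI impI)
  fix u assume "u \<le> t"
  then obtain M where "trace N ((step ^^ u) k) (t - u) k' M"
    using trace_suffix[OF assms(1)] by blast
  then have "gap (t - u + \<Gamma>) ((step ^^ u) k)"
    using gap_before assms(2) by blast
  then show "gap \<Delta> ((step ^^ u) k)"
    by (rule gap_mono) (use assms(3) in simp)
qed

lemma steady_trans:
  assumes "steady \<Delta> k t" "trace N k t k' L" "steady \<Delta> k' u"
  shows "steady \<Delta> k (t + u)"
  unfolding steady_def
proof (intro allI impI)
  fix v assume v: "v \<le> t + u"
  show "gap \<Delta> ((step ^^ v) k)"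
  proof (cases "v \<le> t")
    case False
    then obtain w where w: "v = t + w" by (metis le_Suc_ex nat_le_linear)
    then have "w \<le> u" using v by simp
    then show ?thesis
      using assms(2,3) unfolding w step_add by (simp add: steady_def trace_def)
  qed (use assms(1) in \<open>simp add: steady_def\<close>)
qed

section \<open>Silent iterations of the loop\<close>

abbreviation iteration_time :: "nat \<Rightarrow> nat" where
  "iteration_time n \<equiv> check_time n + fill_time n + 22"

lemma Loop_iteration:
  assumes "bounded_mem N s" "rep n E xs j s" "xs \<noteq> [] \<or> j < n"
    "exec N (check_time n + fill_time n + 21) Body s Q"
  obtains t L s' where "t \<le> iteration_time n" "trace N ([Loop], s) t ([Loop], s') L"
    "bounded_mem N s'" "Q L s'"
proof -
  obtain t L s' where 1: "t \<le> check_time n + fill_time n + 21" "\<And>K. trace N (Body # K, s) t (K, s') L"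
    "bounded_mem N s'" "Q L s'"
    using assms(1,4) unfolding exec_def by blast
  have "bval (Less (Num 0) (Plus (V ''sz'') (Minus (V ''n'') (V ''j'')))) s"
    using assms(2,3) by (cases xs) (auto simp: rep_def graph_loaded_def)
  then have "step ([Loop], s) = ([Body, Loop], s)"
    by (simp add: Loop_def)
  then have "trace N ([Loop], s) (Suc t) ([Loop], s') L"
    using assms(1) by (intro trace_Cons[OF _ _ _ _ 1(2)]) (auto simp: Loop_def)
  moreover have "Suc t \<le> iteration_time n" using 1(1) by simp
  ultimately show ?thesis using that 1(3,4) by blast
qed

lemma Loop_exit:
  assumes "bounded_mem N s" "rep n E [] n s"
  shows "trace N ([Loop], s) 1 ([], s) []"
  using assms by (intro trace_step) (auto simp: Loop_def rep_def graph_loaded_def)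

lemma gap_halted: "gap 0 ([], s)"
  unfolding gap_def
proof (intro allI impI)
  fix m
  assume "\<forall>u<m. emitted ((step ^^ u) ([], s)) = None \<and> fst ((step ^^ u) ([], s)) \<noteq> []"
  then have "0 < m \<Longrightarrow> fst ((step ^^ 0) ([], s)) \<noteq> []" by blast
  then show "m \<le> 0" by (cases m) auto
qed

text \<open>An iteration without output decreases the potential \<open>length xs * Suc n + (n - j)\<close>.\<close>

lemma Loop_gap:
  assumes "bounded_mem N s" "rep n E xs j s" "n * n + n + 2 \<le> N"
  shows "gap ((length xs * Suc n + (n - j) + 1) * iteration_time n) ([Loop], s)"
  using assms(1,2)
proof (induction "length xs * Suc n + (n - j)" arbitrary: xs j s rule: less_induct)
  case less
  let ?\<tau> = "iteration_time n"
  let ?\<phi> = "length xs * Suc n + (n - j)"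
  have next_gap: "gap ((?\<phi> + 1) * ?\<tau>) ([Loop], s)"
    if "trace N ([Loop], s) t ([Loop], s') L" "t \<le> ?\<tau>" "bounded_mem N s'"
      "L = [] \<Longrightarrow> rep n E xs' j' s' \<and> length xs' * Suc n + (n - j') < ?\<phi>" for t s' L xs' j'
  proof -
    have "gap (t + ?\<phi> * ?\<tau>) ([Loop], s)"
    proof (rule gap_before[OF _ that(1)])
      assume "L = []"
      then have *: "rep n E xs' j' s'" "length xs' * Suc n + (n - j') < ?\<phi>"
        using that(4) by auto
      then have "gap ((length xs' * Suc n + (n - j') + 1) * ?\<tau>) ([Loop], s')"
        using less.hyps that(3) by blast
      then show "gap (?\<phi> * ?\<tau>) ([Loop], s')"
        by (rule gap_mono) (use *(2) in \<open>intro mult_le_mono1, simp\<close>)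
    qed
    then show ?thesis
      by (rule gap_mono) (use that(2) in simp)
  qed
  consider "j < n" | "j = n" "xs = []" | ys m where "j = n" "xs = ys @ [m]"
  proof -
    have "j \<le> n" using less.prems(2) by (simp add: rep_def)
    then show thesis using that by (cases xs rule: rev_cases) (auto simp: le_less)
  qed
  then show ?case
  proof cases
    case 1
    obtain t L s' where "t \<le> ?\<tau>" "trace N ([Loop], s) t ([Loop], s') L" "bounded_mem N s'"
      "if open_irredundant n E (insert j (set xs))
        then L = [map (roman_of n E (insert j (set xs))) [0..<n]] \<and> rep n E (xs @ [j]) (Suc j) s'
        else L = [] \<and> rep n E xs (Suc j) s'"
      using Loop_iteration[OF less.prems _ exec_Body_Try[OF less.prems(2) 1 assms(3)]] 1 by blast
    then show ?thesis
      using 1 by (intro next_gap[where xs' = xs and j' = "Suc j"]) (auto split: if_splits)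
  next
    case 2
    have "gap (1 + 0) ([Loop], s)"
      using gap_before[OF gap_halted Loop_exit] less.prems 2 by blast
    then show ?thesis by (rule gap_mono) simp
  next
    case 3
    have rep: "rep n E (ys @ [m]) n s" using less.prems 3 by simp
    then have m: "m < n" by (simp add: rep_def sorted_wrt_append)
    obtain t L s' where "t \<le> ?\<tau>" "trace N ([Loop], s) t ([Loop], s') L" "bounded_mem N s'"
      "L = [] \<and> rep n E ys (Suc m) s'"
      using Loop_iteration[OF less.prems(1) rep _ exec_Body_Pop[OF rep assms(3)]] by blast
    \<comment> \<open>A pop takes j from n back to \<open>Suc m\<close>, which raises n - j to less
      than n, while the stack term drops by \<open>Suc n\<close>.\<close>
    then show ?thesis
      using 3 m by (intro next_gap[where xs' = ys and j' = "Suc m"]) auto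
  qed
qed

abbreviation max_gap :: "nat \<Rightarrow> nat" where
  "max_gap n \<equiv> (n * Suc n + n + 1) * iteration_time n"

lemma Loop_max_gap:
  assumes "bounded_mem N s" "rep n E xs j s" "n * n + n + 2 \<le> N"
  shows "gap (max_gap n) ([Loop], s)"
proof (rule gap_mono[OF Loop_gap[OF assms]])
  have "length xs * Suc n \<le> n * Suc n"
    using rep_bounds(2)[OF assms(2)] by (rule mult_le_mono1)
  then show "(length xs * Suc n + (n - j) + 1) * iteration_time n \<le> max_gap n"
    by (intro mult_le_mono1) simp
qed

text \<open>The recursion that the loop imitates: a preorder listing of the search tree below S,
  without S itself. The argument k counts the vertices left, which makes it primitive
  recursive.\<close>

primrec extensions :: "nat \<Rightarrow> (nat \<times> nat) set \<Rightarrow> nat \<Rightarrow> nat set \<Rightarrow> nat set list" where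
  "extensions n E 0 S = []"
| "extensions n E (Suc k) S =
    (let T = insert (n - Suc k) S in if open_irredundant n E T then T # extensions n E k T else []) @
    extensions n E k S"

abbreviation output_of :: "nat \<Rightarrow> (nat \<times> nat) set \<Rightarrow> nat set \<Rightarrow> nat list" where
  "output_of n E S \<equiv> map (roman_of n E S) [0..<n]"

text \<open>A recursive call corresponds to a segment of the run that ends with the stack it started
  from and with j = n, just before the next pop. A successful attempt is such a segment for the
  larger stack, then a pop, then one for the old stack.\<close>

lemma run_Loop:
  assumes "n * n + n + 2 \<le> N" "bounded_mem N s" "rep n E xs j s" "k = n - j"
  shows "\<exists>T s'. trace N ([Loop], s) T ([Loop], s') (map (output_of n E) (extensions n E k (set xs))) \<and>
    bounded_mem N s' \<and> rep n E xs n s' \<and> steady (iteration_time n + max_gap n) ([Loop], s) T"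
  using assms(2-)
proof (induction k arbitrary: j xs s)
  case 0
  then have "j = n" by (simp add: rep_def)
  moreover have "steady (iteration_time n + max_gap n) ([Loop], s) 0"
    using Loop_max_gap[OF 0(1,2) assms(1)] by (intro steady_trace[OF trace_0]) auto
  ultimately show ?case using 0 trace_0 by fastforce
next
  case (Suc k)
  let ?\<Delta> = "iteration_time n + max_gap n"
  have j: "j < n" "n - Suc k = j" "k = n - Suc j" using Suc.prems(3) by auto
  let ?T = "insert j (set xs)"
  obtain t L s1 where 1: "t \<le> iteration_time n" "trace N ([Loop], s) t ([Loop], s1) L" "bounded_mem N s1"
    "if open_irredundant n E ?T
      then L = [output_of n E ?T] \<and> rep n E (xs @ [j]) (Suc j) s1
      else L = [] \<and> rep n E xs (Suc j) s1"
    using Loop_iteration[OF Suc.prems(1,2) _ exec_Body_Try[OF Suc.prems(2) j(1) assms(1)]] j by blast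
  show ?case
  proof (cases "open_irredundant n E ?T")
    case False
    then have rep1: "L = []" "rep n E xs (Suc j) s1" using 1(4) by auto
    have steady1: "steady ?\<Delta> ([Loop], s) t"
      using 1(1) Loop_max_gap[OF 1(3) rep1(2) assms(1)] by (intro steady_trace[OF 1(2)]) auto
    obtain u s2 where 2: "trace N ([Loop], s1) u ([Loop], s2) (map (output_of n E) (extensions n E k (set xs)))"
      "bounded_mem N s2" "rep n E xs n s2" "steady ?\<Delta> ([Loop], s1) u"
      using Suc.IH[OF 1(3) rep1(2) j(3)] by blast
    have "trace N ([Loop], s) (t + u) ([Loop], s2) (map (output_of n E) (extensions n E (Suc k) (set xs)))"
      using trace_trans[OF 1(2) 2(1)] False rep1(1) j(2) by simp
    moreover have "steady ?\<Delta> ([Loop], s) (t + u)"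
      by (rule steady_trans[OF steady1 1(2) 2(4)])
    ultimately show ?thesis using 2(2,3) by blast
  next
    case True
    then have rep1: "L = [output_of n E ?T]" "rep n E (xs @ [j]) (Suc j) s1" using 1(4) by auto
    have steady1: "steady ?\<Delta> ([Loop], s) t"
      using 1(1) Loop_max_gap[OF 1(3) rep1(2) assms(1)] by (intro steady_trace[OF 1(2)]) auto
    obtain u s2 where 2: "trace N ([Loop], s1) u ([Loop], s2) (map (output_of n E) (extensions n E k (set (xs @ [j]))))"
      "bounded_mem N s2" "rep n E (xs @ [j]) n s2" "steady ?\<Delta> ([Loop], s1) u"
      using Suc.IH[OF 1(3) rep1(2) j(3)] by blast
    obtain v M s3 where 3: "v \<le> iteration_time n" "trace N ([Loop], s2) v ([Loop], s3) M" "bounded_mem N s3"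
      "M = [] \<and> rep n E xs (Suc j) s3"
      using Loop_iteration[OF 2(2,3) _ exec_Body_Pop[OF 2(3) assms(1)]] by blast
    then have rep3: "M = []" "rep n E xs (Suc j) s3" by auto
    have steady3: "steady ?\<Delta> ([Loop], s2) v"
      using 3(1) Loop_max_gap[OF 3(3) rep3(2) assms(1)] by (intro steady_trace[OF 3(2)]) auto
    obtain w s4 where 4: "trace N ([Loop], s3) w ([Loop], s4) (map (output_of n E) (extensions n E k (set xs)))"
      "bounded_mem N s4" "rep n E xs n s4" "steady ?\<Delta> ([Loop], s3) w"
      using Suc.IH[OF 3(3) rep3(2) j(3)] by blast
    have tr: "trace N ([Loop], s2) (v + w) ([Loop], s4) (map (output_of n E) (extensions n E k (set xs)))"
      using trace_trans[OF 3(2) 4(1)] rep3(1) by simp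
    have st: "steady ?\<Delta> ([Loop], s2) (v + w)"
      by (rule steady_trans[OF steady3 3(2) 4(4)])
    have "trace N ([Loop], s) (t + (u + (v + w))) ([Loop], s4) (map (output_of n E) (extensions n E (Suc k) (set xs)))"
      using trace_trans[OF 1(2) trace_trans[OF 2(1) tr]] True rep1(1) j(2) by (simp add: Let_def)
    moreover have "steady ?\<Delta> ([Loop], s) (t + (u + (v + w)))"
      by (rule steady_trans[OF steady1 1(2) steady_trans[OF 2(4) 2(1) st]])
    ultimately show ?thesis using 4(2,3) by blast
  qed
qed

abbreviation delay_bound :: "nat \<Rightarrow> nat" where
  "delay_bound n \<equiv> 4 * n + fill_time n + 8 + iteration_time n + max_gap n"

lemma run_Enumerate:
  assumes "s ''n'' 0 = n" "s ''row'' 0 = 0" "s ''S'' = (\<lambda>_. 0)" "s ''j'' 0 = 0" "s ''sz'' 0 = 0"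
    "\<forall>i<n. \<forall>j<n. s ''adj'' (i * n + j) = (if (i, j) \<in> E then 1 else 0)"
    "n * n + n + 2 \<le> N" "bounded_mem N s"
  obtains T s' where
    "trace N ([Enumerate], s) T ([], s') (map (output_of n E) ({} # extensions n E n {}))"
    "bounded_mem N s'" "steady (delay_bound n) ([Enumerate], s) T"
proof -
  obtain t s1 where 1: "t \<le> 4 * n + fill_time n + 6" "\<And>K. trace N (Pre # K, s) t (K, s1) [output_of n E {}]"
    "bounded_mem N s1" "rep n E [] 0 s1"
    using exec_Pre[OF assms(1-7)] assms(8) unfolding exec_def by blast
  have pre: "trace N ([Enumerate], s) (Suc t) ([Loop], s1) [output_of n E {}]"
    using assms(8) by (intro trace_Cons[OF _ _ _ _ 1(2)]) (auto simp: Enumerate_def)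
  obtain u s2 where 2: "trace N ([Loop], s1) u ([Loop], s2) (map (output_of n E) (extensions n E n {}))"
    "bounded_mem N s2" "rep n E [] n s2" "steady (iteration_time n + max_gap n) ([Loop], s1) u"
    using run_Loop[OF assms(7) 1(3,4), of n] by auto
  note exit = Loop_exit[OF 2(2,3)]
  have loop: "trace N ([Loop], s1) (u + 1) ([], s2) (map (output_of n E) (extensions n E n {}))"
    using trace_trans[OF 2(1) exit] by simp
  have "trace N ([Enumerate], s) (Suc t + (u + 1)) ([], s2) (map (output_of n E) ({} # extensions n E n {}))"
    using trace_trans[OF pre loop] by simp
  moreover have "steady (delay_bound n) ([Enumerate], s) (Suc t + (u + 1))"
  proof (rule steady_trans[OF _ pre steady_trans[OF _ 2(1)]])
    show "steady (delay_bound n) ([Enumerate], s) (Suc t)"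
      by (rule steady_trace[OF pre Loop_max_gap[OF 1(3,4) assms(7)]]) (use 1(1) in simp)
    show "steady (delay_bound n) ([Loop], s1) u"
      using 2(4) by (rule steady_mono) simp
    show "steady (delay_bound n) ([Loop], s2) 1"
      by (rule steady_trace[OF exit gap_halted]) simp
  qed
  ultimately show ?thesis using that 2(2) by blast
qed

section \<open>Delays, total time and space read off from traces\<close>

lemma trace_halts_at: "trace N ([c], s) T ([], s') L \<Longrightarrow> halts_at c s T"
  by (simp add: trace_def halts_at_def run_def)

lemma trace_outputs: "trace N ([c], s) T k L \<Longrightarrow> outputs c s T = L"
  by (simp add: trace_def outputs_def run_def outs_def)

text \<open>\<open>output_times\<close> records the moment after an output step. So a delay consists
  of a silent stretch, bounded by \<open>gap\<close>, and at most one further step, hence the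
  \<open>Suc\<close>.\<close>

lemma delays_le:
  assumes "steady \<Delta> ([c], s) T" "halts_at c s T"
  shows "\<forall>d\<in>set (delays c s T). d \<le> Suc \<Delta>"
proof
  fix d assume "d \<in> set (delays c s T)"
  define ts where "ts = output_times c s T"
  have in_ts: "x \<in> set ts \<longleftrightarrow> (\<exists>t<T. x = Suc t \<and> emitted (run c s t) \<noteq> None)" for x
    by (auto simp: ts_def output_times_def)
  have ts_sorted: "sorted_wrt (<) ts"
    unfolding ts_def output_times_def sorted_wrt_map by (auto intro: sorted_wrt_filter)
  obtain i where i: "i < Suc (length ts)" "d = (ts @ [T]) ! i - (0 # ts) ! i"
    using \<open>d \<in> set (delays c s T)\<close> by (auto simp: delays_def ts_def in_set_conv_nth)
  define lo where "lo = (0 # ts) ! i"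
  define hi where "hi = (ts @ [T]) ! i"
  have hi_T: "hi \<le> T"
    using i in_ts[of hi] by (cases "i < length ts") (auto simp: hi_def nth_append)
  have silent: "emitted (run c s u) = None" if u: "lo \<le> u" "Suc u < hi" for u
  proof (rule ccontr)
    assume "emitted (run c s u) \<noteq> None"
    then have "Suc u \<in> set ts" using in_ts hi_T u by auto
    then obtain m where m: "m < length ts" "ts ! m = Suc u" by (auto simp: in_set_conv_nth)
    have "i \<le> m"
    proof (rule ccontr)
      assume "\<not> i \<le> m"
      then obtain i' where i': "i = Suc i'" "m \<le> i'" by (cases i) auto
      then have "ts ! m \<le> ts ! i'"
        using ts_sorted i(1) by (cases "m = i'") (auto simp: sorted_wrt_iff_nth_less less_imp_le)
      then show False using m(2) u i' by (simp add: lo_def)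
    qed
    then have "ts ! i \<le> ts ! m"
      using ts_sorted m(1) by (cases "m = i") (auto simp: sorted_wrt_iff_nth_less less_imp_le)
    then show False using m u \<open>i \<le> m\<close> by (simp add: hi_def nth_append)
  qed
  show "d \<le> Suc \<Delta>"
  proof (cases "lo < hi")
    case True
    have "emitted ((step ^^ u) (run c s lo)) = None \<and> fst ((step ^^ u) (run c s lo)) \<noteq> []"
      if u: "u < hi - 1 - lo" for u
    proof -
      have "(step ^^ u) (run c s lo) = run c s (lo + u)"
        by (simp add: run_def step_add)
      moreover have "lo \<le> lo + u" "Suc (lo + u) < hi" using u by auto
      ultimately show ?thesis
        using silent[of "lo + u"] assms(2) hi_T by (simp add: halts_at_def)
    qed
    moreover have "gap \<Delta> (run c s lo)"
      using assms(1) True hi_T by (simp add: steady_def run_def)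
    ultimately have "hi - 1 - lo \<le> \<Delta>" unfolding gap_def by blast
    then show ?thesis using i(2) by (simp add: lo_def hi_def)
  qed (use i(2) in \<open>simp add: lo_def hi_def\<close>)
qed

lemma sum_list_differences:
  fixes T :: nat
  assumes "sorted (b # xs @ [T])"
  shows "sum_list (map2 (-) (xs @ [T]) (b # xs)) = T - b"
  using assms
proof (induction xs arbitrary: b)
  case (Cons x xs)
  then have "x \<le> T" "b \<le> x" by auto
  then show ?case using Cons by simp
qed simp

text \<open>The delays telescope to T, and there is one more of them than there are outputs.\<close>

lemma time_le:
  assumes "\<forall>d\<in>set (delays c s T). d \<le> D"
  shows "T \<le> Suc (length (outputs c s T)) * D"
proof -
  define ts where "ts = output_times c s T"
  have "sorted ts"
    unfolding ts_def output_times_def by (simp add: sorted_map sorted_wrt_filter mono_def)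
  moreover have "x \<le> T" if "x \<in> set ts" for x
    using that by (auto simp: ts_def output_times_def)
  ultimately have "sorted (0 # ts @ [T])"
    by (auto simp: sorted_append)
  then have "T = sum_list (delays c s T)"
    using sum_list_differences[of 0 ts T] by (simp add: delays_def ts_def)
  also have "\<dots> \<le> length (delays c s T) * D"
  proof -
    have "sum_list ds \<le> length ds * D" if "\<forall>d\<in>set ds. d \<le> D" for ds
      using that by (induction ds) (auto simp: add_mono)
    then show ?thesis using assms by blast
  qed
  also have "length (delays c s T) = Suc (length (outputs c s T))"
    by (simp add: delays_def output_times_def outputs_def List.map_filter_def)
  finally show ?thesis .
qed

text \<open>14 is the number of names in \<open>vars\<close>. Bounding \<open>floorlog 2 x\<close>
  by x is crude but stays polynomial.\<close>

lemma space_le: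
  assumes "bounded_mem N s"
  shows "space s \<le> 14 * Suc N * Suc (2 * N)"
proof -
  have fl: "floorlog 2 x \<le> x" for x :: nat
    by (rule floorlog_leI) auto
  have "support s \<subseteq> vars \<times> {..N}"
    using assms by (auto simp: support_def bounded_mem_def)
  moreover have fin: "finite (vars \<times> {..N})" by (simp add: vars_def)
  ultimately have "card (support s) \<le> card (vars \<times> {..N})" by (rule card_mono[rotated])
  also have "card (vars \<times> {..N}) = 14 * Suc N"
    by (simp add: card_cartesian_product vars_def)
  finally have card: "card (support s) \<le> 14 * Suc N" .
  have "space s \<le> of_nat (card (support s)) * Suc (2 * N)"
    unfolding space_def
  proof (rule sum_bounded_above)
    fix z assume "z \<in> support s"
    then have "snd z \<le> N" "s (fst z) (snd z) \<le> N"
      using assms by (auto simp: support_def bounded_mem_def)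
    then show "(case z of (x, i) \<Rightarrow> 1 + floorlog 2 i + floorlog 2 (s x i)) \<le> Suc (2 * N)"
      using fl[of "snd z"] fl[of "s (fst z) (snd z)"] by (simp add: case_prod_beta)
  qed
  also have "\<dots> \<le> 14 * Suc N * Suc (2 * N)"
    unfolding of_nat_id using card by (rule mult_le_mono1)
  finally show ?thesis .
qed

text \<open>A neighbour that is private with respect to T stays private when other members are
  dropped.\<close>

lemma open_irredundant_subset:
  "open_irredundant n E T \<Longrightarrow> S \<subseteq> T \<Longrightarrow> open_irredundant n E S"
  unfolding open_irredundant_def by (meson subsetD)

lemma extensions_correct:
  assumes "k \<le> n" "S \<subseteq> {..<n - k}"
  shows "set (extensions n E k S) = {T. open_irredundant n E T \<and> S \<subset> T \<and> T \<subseteq> S \<union> {n - k..<n}} \<and>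
    distinct (extensions n E k S)"
  using assms
proof (induction k arbitrary: S)
  case 0
  then show ?case by auto
next
  case (Suc k)
  define j where "j = n - Suc k"
  have j: "n - k = Suc j" "j < n" using Suc.prems by (auto simp: j_def)
  have jS: "j \<notin> S" using Suc.prems by (auto simp: j_def)
  have range: "{j..<n} = insert j {n - k..<n}" using j by auto
  have S: "S \<subseteq> {..<n - k}" "insert j S \<subseteq> {..<n - k}"
    using Suc.prems j by (auto simp: j_def)
  note IH1 = Suc.IH[OF _ S(1)] and IH2 = Suc.IH[OF _ S(2)]
  have with_j: "set (if open_irredundant n E (insert j S) then insert j S # extensions n E k (insert j S) else []) =
      {T. open_irredundant n E T \<and> S \<subset> T \<and> T \<subseteq> S \<union> {j..<n} \<and> j \<in> T}" (is "?A = ?B")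
  proof (cases "open_irredundant n E (insert j S)")
    case True
    then have "?A = insert (insert j S) {T. open_irredundant n E T \<and> insert j S \<subset> T \<and> T \<subseteq> insert j S \<union> {n - k..<n}}"
      using IH2 Suc.prems by simp
    also have "\<dots> = ?B" using True jS j(2) range by auto
    finally show ?thesis .
  next
    case False
    \<comment> \<open>Heredity justifies the pruning: if \<open>insert j S\<close> fails, so does
      every larger set.\<close>
    then have "\<not> (insert j S \<subseteq> T \<and> open_irredundant n E T)" for T
      using open_irredundant_subset by blast
    then show ?thesis using False by auto
  qed
  have without_j: "set (extensions n E k S) =
      {T. open_irredundant n E T \<and> S \<subset> T \<and> T \<subseteq> S \<union> {j..<n} \<and> j \<notin> T}"
    using IH1 Suc.prems jS j by (auto simp: range)
  have "set (extensions n E (Suc k) S) = ?B \<union> {T. open_irredundant n E T \<and> S \<subset> T \<and> T \<subseteq> S \<union> {j..<n} \<and> j \<notin> T}"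
    unfolding extensions.simps set_append Let_def j_def[symmetric] with_j without_j ..
  moreover have "distinct (extensions n E (Suc k) S)"
  proof -
    have "insert j S \<notin> set (extensions n E k (insert j S))" using IH2 Suc.prems by auto
    then have "distinct (if open_irredundant n E (insert j S) then insert j S # extensions n E k (insert j S) else [])"
      using IH2 Suc.prems by auto
    moreover have "?B \<inter> {T. open_irredundant n E T \<and> S \<subset> T \<and> T \<subseteq> S \<union> {j..<n} \<and> j \<notin> T} = {}" by auto
    ultimately show ?thesis
      unfolding extensions.simps distinct_append Let_def j_def[symmetric] with_j without_j
      using IH1 Suc.prems by auto
  qed
  ultimately show ?case unfolding j_def[symmetric] by blast
qed

section \<open>Minimal Roman dominating functions\<close>

lemma pair_graph_sym:
  assumes "pair_graph G"
  shows "(u, v) \<in> parcs G \<longleftrightarrow> (v, u) \<in> parcs G"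
proof -
  interpret pair_graph G by (rule assms)
  show ?thesis using arcs_symmetric by blast
qed

lemma pair_graph_irrefl:
  assumes "pair_graph G"
  shows "(v, v) \<notin> parcs G"
proof -
  interpret pair_graph G by (rule assms)
  show ?thesis using pair_no_loops[of "(v, v)"] by auto
qed

lemma roman_of_eq_2 [simp]: "roman_of n E S v = 2 \<longleftrightarrow> v \<in> S"
  by (simp add: roman_of_def)

text \<open>A private neighbour p of v has value 0, and v is its only neighbour of value 2. A
  smaller function g keeps 0 at p and has its 2s within S, so it needs the 2 at v. Once g is 2 on S,
  no vertex of value 1 can be lowered.\<close>

lemma minimal_roman_dominating_of_set:
  assumes G: "pair_graph G" "pverts G = {..<n}"
    and S: "S \<subseteq> {..<n}" "open_irredundant n (parcs G) S"
  shows "minimal_roman_dominating G (restrict (roman_of n (parcs G) S) {..<n})"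
proof -
  let ?E = "parcs G"
  let ?f = "restrict (roman_of n ?E S) {..<n}"
  have f: "?f v = 2 \<longleftrightarrow> v \<in> S" if "v < n" for v using that by simp
  have "roman_dominating G ?f"
    unfolding roman_dominating_def G(2)
  proof (intro conjI ballI impI)
    show "?f \<in> {..<n} \<rightarrow>\<^sub>E {0, 1, 2}" by (auto simp: roman_of_def)
    fix v assume "v \<in> {..<n}" "?f v = 0"
    then show "\<exists>u\<in>{..<n}. (v, u) \<in> ?E \<and> ?f u = 2"
      by (force simp: roman_of_def split: if_splits)
  qed
  moreover have "g = ?f" if g: "roman_dominating G g" "\<forall>v\<in>{..<n}. g v \<le> ?f v" for g
  proof -
    have gE: "g \<in> {..<n} \<rightarrow>\<^sub>E {0, 1, 2}"
      and dom: "\<And>v. v < n \<Longrightarrow> g v = 0 \<Longrightarrow> \<exists>u<n. (v, u) \<in> ?E \<and> g u = 2"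
      using g(1) unfolding roman_dominating_def G(2) by (auto simp: Bex_def)
    have two: "u \<in> S" if "u < n" "g u = 2" for u
    proof -
      have "2 \<le> roman_of n ?E S u" using g(2) that by force
      then show ?thesis by (auto simp: roman_of_def split: if_splits)
    qed
    have on_S: "g v = 2" if v: "v \<in> S" for v
    proof -
      obtain p where p: "p < n" "(v, p) \<in> ?E" "\<And>u. u \<in> S \<Longrightarrow> u \<noteq> v \<Longrightarrow> u \<noteq> p \<and> (p, u) \<notin> ?E"
        using S(2) v by (auto simp: open_irredundant_def)
      have "p \<noteq> v" using p(2) pair_graph_irrefl[OF G(1)] by auto
      then have "p \<notin> S" using p(3) by blast
      moreover have "(p, v) \<in> ?E" using p(2) pair_graph_sym[OF G(1)] by simp
      ultimately have "roman_of n ?E S p = 0" using v S(1) by (auto simp: roman_of_def)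
      then have "g p = 0" using g(2) p(1) by force
      then obtain u where "u < n" "(p, u) \<in> ?E" "g u = 2" using dom p(1) by blast
      then show "g v = 2" using two p(3) by blast
    qed
    show ?thesis
    proof (rule PiE_ext[OF gE])
      show "?f \<in> {..<n} \<rightarrow>\<^sub>E {0, 1, 2}" by (auto simp: roman_of_def)
      fix v assume v: "v \<in> {..<n}"
      consider "v \<in> S" | "?f v = 0" | "?f v = 1" "v \<notin> S"
      proof -
        have "v \<in> S \<or> ?f v = 0 \<or> ?f v = 1 \<and> v \<notin> S"
          using v by (simp add: roman_of_def)
        then show thesis using that by blast
      qed
      then show "g v = ?f v"
      proof cases
        case 1
        then show ?thesis using on_S v by simp
      next
        case 2
        then show ?thesis using g(2) v by force
      next
        case 3
        have "g v \<noteq> 0"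
        proof
          assume "g v = 0"
          then obtain u where "u < n" "(v, u) \<in> ?E" "g u = 2" using dom v by auto
          then have "?f v = 0" using two 3(2) v by (auto simp: roman_of_def)
          then show False using 3 by simp
        qed
        moreover have "g v \<le> 1" using g(2) v 3(1) by force
        ultimately show ?thesis using 3(1) by simp
      qed
    qed
  qed
  ultimately show ?thesis
    unfolding minimal_roman_dominating_def G(2) by blast
qed

text \<open>If v in S had no private neighbour, its value could be lowered to 1, since each vertex
  of value 0 next to v has another neighbour of value 2. Likewise, a vertex of value 1 with a
  neighbour of value 2 could be lowered to 0.\<close>

lemma set_of_minimal_roman_dominating:
  assumes G: "pair_graph G" "pverts G = {..<n}"
    and f: "minimal_roman_dominating G f"
  defines "S \<equiv> {v. v < n \<and> f v = 2}"
  shows "open_irredundant n (parcs G) S" "f = restrict (roman_of n (parcs G) S) {..<n}"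
proof -
  let ?E = "parcs G"
  have fE: "f \<in> {..<n} \<rightarrow>\<^sub>E {0, 1, 2}"
    and dom: "\<And>v. v < n \<Longrightarrow> f v = 0 \<Longrightarrow> \<exists>u<n. (v, u) \<in> ?E \<and> f u = 2"
  proof -
    have "roman_dominating G f" using f by (simp add: minimal_roman_dominating_def)
    then show "f \<in> {..<n} \<rightarrow>\<^sub>E {0, 1, 2}" "\<And>v. v < n \<Longrightarrow> f v = 0 \<Longrightarrow> \<exists>u<n. (v, u) \<in> ?E \<and> f u = 2"
      unfolding roman_dominating_def G(2) by (auto simp: Bex_def)
  qed
  have no_smaller: "\<not> roman_dominating G (f(v := c))" if "v < n" "c < f v" for v c
  proof
    assume "roman_dominating G (f(v := c))"
    moreover have "f(v := c) \<noteq> f" using that by (simp add: fun_upd_idem_iff)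
    moreover have "\<forall>w\<in>pverts G. (f(v := c)) w \<le> f w" using that by auto
    ultimately show False using f unfolding minimal_roman_dominating_def by blast
  qed
  have upd: "f(v := c) \<in> {..<n} \<rightarrow>\<^sub>E {0, 1, 2}" if "v < n" "c \<in> {0, 1, 2}" for v c
    using fE that by (auto simp: PiE_iff extensional_def)
  show "open_irredundant n ?E S"
  proof (rule ccontr)
    assume "\<not> ?thesis"
    then obtain v where v: "v \<in> S"
      and no: "\<And>p. p < n \<Longrightarrow> (v, p) \<in> ?E \<Longrightarrow> \<exists>u\<in>S. u \<noteq> v \<and> (u = p \<or> (p, u) \<in> ?E)"
      unfolding open_irredundant_def by blast
    have "roman_dominating G (f(v := 1))"
      unfolding roman_dominating_def G(2)
    proof (intro conjI ballI impI)
      show "f(v := 1) \<in> {..<n} \<rightarrow>\<^sub>E {0, 1, 2}" using upd v by (simp add: S_def)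
      fix w assume w: "w \<in> {..<n}" "(f(v := 1)) w = 0"
      then have "w \<noteq> v" "f w = 0" by (auto split: if_splits)
      then obtain u where u: "u < n" "(w, u) \<in> ?E" "f u = 2" using dom[of w] w by auto
      show "\<exists>u\<in>{..<n}. (w, u) \<in> ?E \<and> (f(v := 1)) u = 2"
      proof (cases "u = v")
        case True
        then have "(v, w) \<in> ?E" using u pair_graph_sym[OF G(1)] by simp
        then obtain u' where "u' \<in> S" "u' \<noteq> v" "u' = w \<or> (w, u') \<in> ?E" using no w by auto
        moreover from this have "f u' = 2" "u' < n" by (auto simp: S_def)
        ultimately have "(w, u') \<in> ?E" "(f(v := 1)) u' = 2" using \<open>f w = 0\<close> by auto
        then show ?thesis using \<open>u' < n\<close> by (intro bexI[of _ u']) auto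
      next
        case False
        then have "(f(v := 1)) u = 2" using u by simp
        then show ?thesis using u by (intro bexI[of _ u]) auto
      qed
    qed
    then show False using no_smaller[of v 1] v by (simp add: S_def)
  qed
  show "f = restrict (roman_of n ?E S) {..<n}"
  proof (rule PiE_ext[OF fE])
    show "restrict (roman_of n ?E S) {..<n} \<in> {..<n} \<rightarrow>\<^sub>E {0, 1, 2}" by (auto simp: roman_of_def)
    fix v assume v: "v \<in> {..<n}"
    have "f v \<in> {0, 1, 2}" by (rule PiE_mem[OF fE v])
    then have "f v = 2 \<or> f v = 0 \<or> f v = 1" by auto
    then have "f v = roman_of n ?E S v"
    proof (elim disjE)
      assume 2: "f v = 0"
      then obtain u where "u < n" "(v, u) \<in> ?E" "f u = 2" using dom[of v] v by auto
      then have "\<exists>u<n. u \<in> S \<and> (v, u) \<in> ?E" by (auto simp: S_def)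
      moreover have "v \<notin> S" using 2 by (simp add: S_def)
      ultimately show ?thesis using 2 unfolding roman_of_def by simp
    next
      assume 3: "f v = 1"
      have "(v, u) \<notin> ?E" if u: "u < n" "f u = 2" for u
      proof
        assume vu: "(v, u) \<in> ?E"
        have "roman_dominating G (f(v := 0))"
          unfolding roman_dominating_def G(2)
        proof (intro conjI ballI impI)
          show "f(v := 0) \<in> {..<n} \<rightarrow>\<^sub>E {0, 1, 2}" using upd v by simp
          fix w assume w: "w \<in> {..<n}" "(f(v := 0)) w = 0"
          show "\<exists>u\<in>{..<n}. (w, u) \<in> ?E \<and> (f(v := 0)) u = 2"
          proof (cases "w = v")
            case True
            then have "(w, u) \<in> ?E" "(f(v := 0)) u = 2" using vu u 3 by auto
            then show ?thesis using u(1) by (intro bexI[of _ u]) auto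
          next
            case False
            then obtain u' where u': "u' < n" "(w, u') \<in> ?E" "f u' = 2" using dom[of w] w by auto
            then have "(f(v := 0)) u' = 2" using 3 by auto
            then show ?thesis using u' by (intro bexI[of _ u']) auto
          qed
        qed
        then show False using no_smaller[of v 0] v 3 by simp
      qed
      then have "\<not> (\<exists>u<n. u \<in> S \<and> (v, u) \<in> ?E)" by (auto simp: S_def)
      moreover have "v \<notin> S" using 3 by (simp add: S_def)
      ultimately show ?thesis using 3 unfolding roman_of_def by simp
    next
      assume "f v = 2"
      then show ?thesis using v by (simp add: roman_of_def S_def)
    qed
    then show "f v = restrict (roman_of n ?E S) {..<n} v" using v by simp
  qed
qed

lemma minimal_roman_dominating_outputs:
  assumes "pair_graph G" "pverts G = {..<n}"
  shows "(\<lambda>f. map f [0..<n]) ` {f. minimal_roman_dominating G f} =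
    output_of n (parcs G) ` {S. S \<subseteq> {..<n} \<and> open_irredundant n (parcs G) S}" (is "?L = ?R")
proof
  have map: "map (restrict g {..<n}) [0..<n] = map g [0..<n]" for g :: "nat \<Rightarrow> nat" by simp
  show "?L \<subseteq> ?R"
  proof
    fix l assume "l \<in> ?L"
    then obtain f where f: "minimal_roman_dominating G f" "l = map f [0..<n]" by auto
    let ?S = "{v. v < n \<and> f v = 2}"
    have "l = output_of n (parcs G) ?S"
      using f(2) set_of_minimal_roman_dominating(2)[OF assms f(1)] map by metis
    moreover have "?S \<subseteq> {..<n}" by auto
    ultimately show "l \<in> ?R"
      using set_of_minimal_roman_dominating(1)[OF assms f(1)] by blast
  qed
  show "?R \<subseteq> ?L"
  proof
    fix l assume "l \<in> ?R"
    then obtain S where "S \<subseteq> {..<n}" "open_irredundant n (parcs G) S" "l = output_of n (parcs G) S" by auto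
    then show "l \<in> ?L"
      using minimal_roman_dominating_of_set[OF assms] map[of "roman_of n (parcs G) S"]
      by (intro image_eqI[of _ _ "restrict (roman_of n (parcs G) S) {..<n}"]) auto
  qed
qed

lemma inj_on_output_of: "inj_on (output_of n E) {S. S \<subseteq> {..<n} \<and> P S}"
proof (rule inj_onI)
  fix S T assume *: "S \<in> {S. S \<subseteq> {..<n} \<and> P S}" "T \<in> {S. S \<subseteq> {..<n} \<and> P S}"
    "output_of n E S = output_of n E T"
  then have "roman_of n E S v = roman_of n E T v" if "v < n" for v
    using that by simp
  then have "v \<in> S \<longleftrightarrow> v \<in> T" if "v < n" for v
    using that roman_of_eq_2 by metis
  then show "S = T" using * by blast
qed

text \<open>An inclusion into the family counted for intervals is enough. Loop-freeness shows that a
  private neighbour lies outside S.\<close>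

lemma card_interval_open_irredundant_le:
  assumes G: "pair_graph G" "pverts G = {..<n}" "interval_graph G"
  shows "real (card {S. S \<subseteq> {..<n} \<and> open_irredundant n (parcs G) S}) \<le> real (n + 1) * sqrt 3 ^ n"
proof -
  obtain l r :: "nat \<Rightarrow> real" where lr: "\<forall>v\<in>{..<n}. l v \<le> r v"
    "\<forall>u\<in>{..<n}. \<forall>v\<in>{..<n}. u \<noteq> v \<longrightarrow> ((u, v) \<in> parcs G \<longleftrightarrow> {l u..r u} \<inter> {l v..r v} \<noteq> {})"
    using G(3) unfolding interval_graph_def G(2) by blast
  interpret interval_family "{..<n}" l r
    by unfold_locales (use lr in auto)
  have adj: "(u, v) \<in> parcs G \<longleftrightarrow> adjacent u v" if "u < n" "v < n" for u v
  proof (cases "u = v")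
    case True
    then show ?thesis using pair_graph_irrefl[OF G(1)] by (simp add: adjacent_def)
  next
    case False
    then have "(u, v) \<in> parcs G \<longleftrightarrow> {l u..r u} \<inter> {l v..r v} \<noteq> {}" using lr that by auto
    also have "\<dots> \<longleftrightarrow> l u \<le> r v \<and> l v \<le> r u" using lr(1) that by (auto simp: Int_atLeastAtMost)
    finally show ?thesis using False by (simp add: adjacent_def)
  qed
  have "{S. S \<subseteq> {..<n} \<and> open_irredundant n (parcs G) S} \<subseteq>
    {S. S \<subseteq> {..<n} \<and> (\<forall>s\<in>S. \<exists>p\<in>{..<n}. p \<notin> S \<and> adjacent s p \<and> (\<forall>t\<in>S. t \<noteq> s \<longrightarrow> \<not> adjacent t p))}"
  proof (intro subsetI CollectI conjI ballI)
    fix S s assume "S \<in> {S. S \<subseteq> {..<n} \<and> open_irredundant n (parcs G) S}" and s: "s \<in> S"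
    then have S: "S \<subseteq> {..<n}" "open_irredundant n (parcs G) S" by auto
    obtain p where p: "p < n" "(s, p) \<in> parcs G" "\<And>u. u \<in> S \<Longrightarrow> u \<noteq> s \<Longrightarrow> u \<noteq> p \<and> (p, u) \<notin> parcs G"
      using S(2) s by (auto simp: open_irredundant_def)
    have "p \<noteq> s" using p(2) pair_graph_irrefl[OF G(1)] by auto
    then have "p \<notin> S" using p(3) by blast
    moreover have "adjacent s p" using adj p s S(1) by auto
    moreover have "\<not> adjacent t p" if "t \<in> S" "t \<noteq> s" for t
      using adj[of t p] p(1) p(3)[OF that] pair_graph_sym[OF G(1)] that S(1) by auto
    ultimately show "\<exists>p\<in>{..<n}. p \<notin> S \<and> adjacent s p \<and> (\<forall>t\<in>S. t \<noteq> s \<longrightarrow> \<not> adjacent t p)"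
      using p(1) by auto
  qed auto
  then have "card {S. S \<subseteq> {..<n} \<and> open_irredundant n (parcs G) S} \<le>
    card {S. S \<subseteq> {..<n} \<and> (\<forall>s\<in>S. \<exists>p\<in>{..<n}. p \<notin> S \<and> adjacent s p \<and> (\<forall>t\<in>S. t \<noteq> s \<longrightarrow> \<not> adjacent t p))}"
    by (intro card_mono) auto
  then show ?thesis using card_open_irredundant_le by simp
qed

section \<open>Polynomial bounds and the final assembly\<close>

definition polynomial_fun :: "(nat \<Rightarrow> nat) \<Rightarrow> bool" where
  "polynomial_fun f \<longleftrightarrow> (\<exists>p :: nat poly. \<forall>n. poly p n = f n)"

text \<open>The nested time bounds are recognised as polynomials by their syntax, without computing
  coefficients.\<close>

lemma polynomial_fun_intros:
  "polynomial_fun (\<lambda>n. n)" "polynomial_fun (\<lambda>n. c)"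
  "polynomial_fun f \<Longrightarrow> polynomial_fun g \<Longrightarrow> polynomial_fun (\<lambda>n. f n + g n)"
  "polynomial_fun f \<Longrightarrow> polynomial_fun g \<Longrightarrow> polynomial_fun (\<lambda>n. f n * g n)"
  "polynomial_fun f \<Longrightarrow> polynomial_fun (\<lambda>n. Suc (f n))"
proof -
  show "polynomial_fun (\<lambda>n. n)"
    unfolding polynomial_fun_def by (rule exI[of _ "[:0, 1:]"]) simp
  show const: "polynomial_fun (\<lambda>n. c)" for c
    unfolding polynomial_fun_def by (rule exI[of _ "[:c:]"]) simp
  show add: "polynomial_fun (\<lambda>n. f n + g n)" if fg: "polynomial_fun f" "polynomial_fun g" for f g
  proof -
    obtain p q where "\<forall>n. poly p n = f n" "\<forall>n. poly q n = g n"
      using fg unfolding polynomial_fun_def by blast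
    then have "\<forall>n. poly (p + q) n = f n + g n" by simp
    then show ?thesis unfolding polynomial_fun_def by blast
  qed
  show "polynomial_fun (\<lambda>n. f n * g n)" if fg: "polynomial_fun f" "polynomial_fun g"
  proof -
    obtain p q where "\<forall>n. poly p n = f n" "\<forall>n. poly q n = g n"
      using fg unfolding polynomial_fun_def by blast
    then have "\<forall>n. poly (p * q) n = f n * g n" by simp
    then show ?thesis unfolding polynomial_fun_def by blast
  qed
  show "polynomial_fun (\<lambda>n. Suc (f n))" if "polynomial_fun f"
    using add[OF that const[of 1]] by simp
qed

lemma bounded_mem_input: "n * n + n + 2 \<le> N \<Longrightarrow> bounded_mem N (input_mem n G)"
proof -
  assume N: "n * n + n + 2 \<le> N"
  have "i * n + j \<le> N" if "i < n" "j < n" for i j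
  proof -
    have "i * n \<le> n * n" using that by (intro mult_le_mono1) simp
    then show ?thesis using that N by linarith
  qed
  then show ?thesis
    using N by (auto simp: bounded_mem_def input_mem_def vars_def split: if_splits)
qed

text \<open>The input is defined by an existential over index pairs; division with remainder shows
  that the address determines the pair.\<close>

lemma input_mem_adj:
  assumes "i < n" "j < n"
  shows "input_mem n G ''adj'' (i * n + j) = (if (i, j) \<in> parcs G then 1 else 0)"
proof -
  have "i' = i \<and> j' = j" if "i' < n" "j' < n" "i * n + j = i' * n + j'" for i' j'
  proof -
    have "(i * n + j) div n = i" "(i * n + j) mod n = j" using assms by simp_all
    moreover have "(i' * n + j') div n = i'" "(i' * n + j') mod n = j'" using that(1,2) by simp_all
    ultimately show ?thesis unfolding that(3) by simp
  qed
  then show ?thesis using assms by (auto simp: input_mem_def)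
qed

lemma enumeration:
  assumes G: "pair_graph G" "pverts G = {..<n}" "interval_graph G"
  shows "\<exists>T. halts_at Enumerate (input_mem n G) T \<and>
    distinct (outputs Enumerate (input_mem n G) T) \<and>
    set (outputs Enumerate (input_mem n G) T) =
      (\<lambda>f. map f [0..<n]) ` {f. minimal_roman_dominating G f} \<and>
    real T \<le> real ((n + 2) * Suc (delay_bound n)) * sqrt 3 ^ n \<and>
    (\<forall>d \<in> set (delays Enumerate (input_mem n G) T). d \<le> Suc (delay_bound n)) \<and>
    (\<forall>t\<le>T. space (snd (run Enumerate (input_mem n G) t)) \<le>
      14 * Suc (n * n + n + 2) * Suc (2 * (n * n + n + 2)))"
proof -
  let ?E = "parcs G" and ?N = "n * n + n + 2"
  let ?s = "input_mem n G"
  have input: "?s ''n'' 0 = n" "?s ''row'' 0 = 0" "?s ''S'' = (\<lambda>_. 0)" "?s ''j'' 0 = 0" "?s ''sz'' 0 = 0"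
    by (simp_all add: input_mem_def)
  have adj: "\<forall>i<n. \<forall>j<n. ?s ''adj'' (i * n + j) = (if (i, j) \<in> ?E then 1 else 0)"
    using input_mem_adj by simp
  have bounded: "bounded_mem ?N ?s" by (rule bounded_mem_input) simp
  obtain T s' where T:
    "trace ?N ([Enumerate], ?s) T ([], s') (map (output_of n ?E) ({} # extensions n ?E n {}))"
    "bounded_mem ?N s'" "steady (delay_bound n) ([Enumerate], ?s) T"
    by (rule run_Enumerate[where N = ?N and n = n and s = ?s and E = ?E, OF input adj order_refl bounded])
  let ?F = "{S. S \<subseteq> {..<n} \<and> open_irredundant n ?E S}"
  have oi_empty: "open_irredundant n ?E {}" by (simp add: open_irredundant_def)
  have ext: "set (extensions n ?E n {}) = {S. open_irredundant n ?E S \<and> {} \<subset> S \<and> S \<subseteq> {..<n}}"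
    "distinct (extensions n ?E n {})"
    using extensions_correct[of n n "{}" ?E] by (auto simp: atLeast0LessThan)
  have sets: "set ({} # extensions n ?E n {}) = ?F" "distinct ({} # extensions n ?E n {})"
    using ext oi_empty by auto
  have halts: "halts_at Enumerate ?s T" by (rule trace_halts_at[OF T(1)])
  have outs: "outputs Enumerate ?s T = map (output_of n ?E) ({} # extensions n ?E n {})"
    by (rule trace_outputs[OF T(1)])
  have "distinct (outputs Enumerate ?s T)"
    unfolding outs distinct_map sets(1) using sets(2) inj_on_output_of by blast
  moreover have "set (outputs Enumerate ?s T) = (\<lambda>f. map f [0..<n]) ` {f. minimal_roman_dominating G f}"
    unfolding outs set_map sets(1) minimal_roman_dominating_outputs[OF G(1,2)] ..
  moreover have delays: "\<forall>d\<in>set (delays Enumerate ?s T). d \<le> Suc (delay_bound n)"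
    by (rule delays_le[OF T(3) halts])
  moreover have "real T \<le> real ((n + 2) * Suc (delay_bound n)) * sqrt 3 ^ n"
  proof -
    have "length (outputs Enumerate ?s T) = card ?F"
      unfolding outs length_map sets(1)[symmetric] by (rule distinct_card[OF sets(2), symmetric])
    then have "real T \<le> real (Suc (card ?F) * Suc (delay_bound n))"
      using time_le[OF delays] by (simp only: of_nat_le_iff)
    also have "\<dots> = (1 + real (card ?F)) * real (Suc (delay_bound n))"
      by (simp only: of_nat_mult of_nat_Suc add.commute)
    also have "\<dots> \<le> (real (n + 2) * sqrt 3 ^ n) * real (Suc (delay_bound n))"
    proof (rule mult_right_mono)
      \<comment> \<open>The extra 1 accounts for the time after the last output; absorbing it turns
        n + 1 into n + 2.\<close>
      have "1 \<le> sqrt (3::real) ^ n" by (rule one_le_power) simp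
      moreover have "real (n + 2) * sqrt 3 ^ n = real (n + 1) * sqrt 3 ^ n + sqrt 3 ^ n"
        by (simp add: algebra_simps)
      ultimately show "1 + real (card ?F) \<le> real (n + 2) * sqrt 3 ^ n"
        using card_interval_open_irredundant_le[OF G] by linarith
    qed simp
    also have "\<dots> = real ((n + 2) * Suc (delay_bound n)) * sqrt 3 ^ n"
      by (simp only: of_nat_mult ac_simps)
    finally show ?thesis .
  qed
  moreover have "space (snd (run Enumerate ?s t)) \<le> 14 * Suc ?N * Suc (2 * ?N)" if "t \<le> T" for t
  proof (rule space_le)
    show "bounded_mem ?N (snd (run Enumerate ?s t))"
      using T(1,2) that by (cases "t = T") (auto simp: trace_def run_def)
  qed
  ultimately show ?thesis using halts by blast
qed

theorem theorem4:
  shows "\<exists>(c :: com) (time :: nat poly) (delay :: nat poly) (mspace :: nat poly).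
    \<forall>(n :: nat) (G :: nat pair_pre_digraph).
      pair_graph G \<and> pverts G = {..<n} \<and> interval_graph G \<longrightarrow>
      (\<exists>T. halts_at c (input_mem n G) T \<and>
        distinct (outputs c (input_mem n G) T) \<and>
        set (outputs c (input_mem n G) T) =
          (\<lambda>f. map f [0..<n]) ` {f. minimal_roman_dominating G f} \<and>
        real T \<le> real (poly time n) * sqrt 3 ^ n \<and>
        (\<forall>d \<in> set (delays c (input_mem n G) T). d \<le> poly delay n) \<and>
        (\<forall>t\<le>T. space (snd (run c (input_mem n G) t)) \<le> poly mspace n))"
proof -
  have "polynomial_fun (\<lambda>n. (n + 2) * Suc (delay_bound n))"
    by (intro polynomial_fun_intros)
  then obtain time where time: "\<And>n. poly time n = (n + 2) * Suc (delay_bound n)"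
    unfolding polynomial_fun_def by blast
  have "polynomial_fun (\<lambda>n. Suc (delay_bound n))"
    by (intro polynomial_fun_intros)
  then obtain delay where delay: "\<And>n. poly delay n = Suc (delay_bound n)"
    unfolding polynomial_fun_def by blast
  have "polynomial_fun (\<lambda>n. 14 * Suc (n * n + n + 2) * Suc (2 * (n * n + n + 2)))"
    by (intro polynomial_fun_intros)
  then obtain mspace where mspace: "\<And>n. poly mspace n = 14 * Suc (n * n + n + 2) * Suc (2 * (n * n + n + 2))"
    unfolding polynomial_fun_def by blast
  show ?thesis
  proof (rule exI[of _ Enumerate], rule exI[of _ time], rule exI[of _ delay], rule exI[of _ mspace],
      intro allI impI)
    fix n :: nat and G :: "nat pair_pre_digraph"
    assume "pair_graph G \<and> pverts G = {..<n} \<and> interval_graph G"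
    then have "pair_graph G" "pverts G = {..<n}" "interval_graph G" by auto
    from enumeration[OF this] show "\<exists>T. halts_at Enumerate (input_mem n G) T \<and>
        distinct (outputs Enumerate (input_mem n G) T) \<and>
        set (outputs Enumerate (input_mem n G) T) =
          (\<lambda>f. map f [0..<n]) ` {f. minimal_roman_dominating G f} \<and>
        real T \<le> real (poly time n) * sqrt 3 ^ n \<and>
        (\<forall>d \<in> set (delays Enumerate (input_mem n G) T). d \<le> poly delay n) \<and>
        (\<forall>t\<le>T. space (snd (run Enumerate (input_mem n G) t)) \<le> poly mspace n)"
      unfolding time delay mspace .
  qed
qed

end
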